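(* Let $\langle T,<,(\mathcal{M}_t)_{t\in T}\rangle$ be an $\omega$-pure family tree in which $\mathcal{M}_t$ is indivisible for every $t\in T$, and let $\mathcal{D}\subset\prod^{\bar s}_{t\in T}\mathcal{M}_t$ be a countable dense substructure. Then $\mathcal{D}$ is elementarily indivisible.
   Context: A Hausdorff tree is a partial order $\langle T,<\rangle$ with a least element, such that $\{s: s<t\}$ is well ordered for each $t$, and any two distinct $a,b\in T$ have a greatest common lower bound $a\wedge b$. $\mathrm{height}(t)$ is the order type of $\{s:s<t\}$, $\mathrm{suc}(t)$ is the set of immediate successors of $t$, and $\mathrm{branch}(T)$ is the set of maximal chains. Standing convention: $T$ has no maximal elements, is leveled (all branches have the same height), and $\mathrm{height}(T)$ has infinite cofinality. For a branch $b$ and $t\in b$, $S_b(t)=\min\{s\in b: s>t\}$. A family tree $\langle T,<,(\mathcal{M}_t)_{t\in T}\rangle$ consists of such a tree and $\mathcal{L}$-structures $\mathcal{M}_t$ ($\mathcal{L}$ relational) with universe $\mathrm{suc}(t)$. The product $\prod_{t\in T}\mathcal{M}_t$ has universe $\mathrm{branch}(T)$, and for $k$-ary $R\in\mathcal{L}$, $R(a_1,\dots,a_k)$ holds iff $\mathcal{M}_m\models R(S_{a_1}(m),\dots,S_{a_k}(m))$ where $m=a_1\wedge\dots\wedge a_k$ is the greatest element of $a_1\cap\dots\cap a_k$. For a sequence $\bar s=\langle s_\alpha:1\le\alpha<\mathrm{height}(T)\rangle$ of distinct new binary symbols, $\prod^{\bar s}_{t\in T}\mathcal{M}_t$ is the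 expansion in which $s_\alpha(a,b)$ holds iff $\mathrm{height}(a\wedge b)\ge\alpha$. A substructure of the product is dense if every $t\in T$ belongs to some branch in it. The family tree is $\omega$-pure if $T$ is countably infinite, every $\mathcal{M}_t$ is countably infinite, transitive (its theory has a unique complete 1-type) and ultrahomogeneous (every finite partial isomorphism extends to an automorphism), and $\mathrm{height}(t)=\mathrm{height}(u)$ implies $\mathcal{M}_t\cong\mathcal{M}_u$. A structure $\mathcal{M}$ is indivisible if for every coloring of its universe in two colors there is a monochromatic substructure $\mathcal{M}'\subseteq\mathcal{M}$ with $\mathcal{M}'\cong\mathcal{M}$; it is elementarily indivisible if moreover $\mathcal{M}'$ can always be chosen with $\mathcal{M}'\cong\mathcal{M}$ and $\mathcal{M}'\prec\mathcal{M}$. *)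

theory Defs
  imports Complex_Main "HOL-Library.Countable_Set"
begin

section \<open>First-order logic over relational languages\<close>

text \<open>The domain of the partial map is the set of symbols, the value is the arity.
  In this way the empty language is included.\<close>

type_synonym 'r language = "'r \<rightharpoonup> nat"

datatype 'r fm =
    Eq nat nat
  | Rel 'r "nat list"
  | Neg "'r fm"
  | Conj "'r fm" "'r fm"
  | Exi nat "'r fm"

primrec wf_fm :: "'r language \<Rightarrow> 'r fm \<Rightarrow> bool" where
  "wf_fm L (Eq i j) \<longleftrightarrow> True"
| "wf_fm L (Rel R xs) \<longleftrightarrow> L R = Some (length xs)"
| "wf_fm L (Neg \<phi>) \<longleftrightarrow> wf_fm L \<phi>"
| "wf_fm L (Conj \<phi> \<psi>) \<longleftrightarrow> wf_fm L \<phi> \<and> wf_fm L \<psi>"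
| "wf_fm L (Exi i \<phi>) \<longleftrightarrow> wf_fm L \<phi>"

primrec fv :: "'r fm \<Rightarrow> nat set" where
  "fv (Eq i j) = {i, j}"
| "fv (Rel R xs) = set xs"
| "fv (Neg \<phi>) = fv \<phi>"
| "fv (Conj \<phi> \<psi>) = fv \<phi> \<union> fv \<psi>"
| "fv (Exi i \<phi>) = fv \<phi> - {i}"

text \<open>Only the values of \<open>rel \<M> R\<close> at lists over the universe whose length is the arity
  of \<open>R\<close> are meaningful; all notions below ignore the others.\<close>

record ('r, 'a) struct =
  univ :: "'a set"
  rel :: "'r \<Rightarrow> 'a list \<Rightarrow> bool"

primrec sat :: "('r, 'a) struct \<Rightarrow> (nat \<Rightarrow> 'a) \<Rightarrow> 'r fm \<Rightarrow> bool" where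
  "sat \<M> e (Eq i j) \<longleftrightarrow> e i = e j"
| "sat \<M> e (Rel R xs) \<longleftrightarrow> rel \<M> R (map e xs)"
| "sat \<M> e (Neg \<phi>) \<longleftrightarrow> \<not> sat \<M> e \<phi>"
| "sat \<M> e (Conj \<phi> \<psi>) \<longleftrightarrow> sat \<M> e \<phi> \<and> sat \<M> e \<psi>"
| "sat \<M> e (Exi i \<phi>) \<longleftrightarrow> (\<exists>a\<in>univ \<M>. sat \<M> (e(i := a)) \<phi>)"

definition models :: "('r, 'a) struct \<Rightarrow> 'r fm \<Rightarrow> bool" where
  "models \<M> \<phi> \<longleftrightarrow> (\<forall>e. range e \<subseteq> univ \<M> \<longrightarrow> sat \<M> e \<phi>)"

definition Th :: "'r language \<Rightarrow> ('r, 'a) struct \<Rightarrow> 'r fm set" where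
  "Th L \<M> = {\<phi>. wf_fm L \<phi> \<and> fv \<phi> = {} \<and> models \<M> \<phi>}"

text \<open>The models by which consistency of \<open>p\<close> with \<open>\<Sigma>\<close> is witnessed have their universe
  inside the type of formulas. By the downward Loewenheim-Skolem theorem this
  is no restriction, since that type has cardinality at least \<open>|L| + \<aleph>\<^sub>0\<close>.\<close>

definition complete_1type :: "'r language \<Rightarrow> 'r fm set \<Rightarrow> 'r fm set \<Rightarrow> bool" where
  "complete_1type L \<Sigma> p \<longleftrightarrow>
     p \<subseteq> {\<phi>. wf_fm L \<phi> \<and> fv \<phi> \<subseteq> {0}} \<and>
     (\<forall>\<phi>. wf_fm L \<phi> \<and> fv \<phi> \<subseteq> {0} \<longrightarrow> \<phi> \<in> p \<or> Neg \<phi> \<in> p) \<and>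
     (\<exists>(\<N> :: ('r, 'r fm) struct) a. a \<in> univ \<N> \<and>
        (\<forall>\<phi>\<in>\<Sigma>. models \<N> \<phi>) \<and> (\<forall>\<phi>\<in>p. sat \<N> (\<lambda>_. a) \<phi>))"

definition transitive_struct :: "'r language \<Rightarrow> ('r, 'a) struct \<Rightarrow> bool" where
  "transitive_struct L \<M> \<longleftrightarrow> (\<exists>!p. complete_1type L (Th L \<M>) p)"

definition partial_iso ::
    "'r language \<Rightarrow> ('r, 'a) struct \<Rightarrow> ('r, 'b) struct \<Rightarrow> 'a set \<Rightarrow> ('a \<Rightarrow> 'b) \<Rightarrow> bool" where
  "partial_iso L \<M> \<N> A f \<longleftrightarrow>
     A \<subseteq> univ \<M> \<and> f ` A \<subseteq> univ \<N> \<and> inj_on f A \<and>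
     (\<forall>R xs. set xs \<subseteq> A \<and> L R = Some (length xs) \<longrightarrow> (rel \<M> R xs \<longleftrightarrow> rel \<N> R (map f xs)))"

definition iso_map ::
    "'r language \<Rightarrow> ('r, 'a) struct \<Rightarrow> ('r, 'b) struct \<Rightarrow> ('a \<Rightarrow> 'b) \<Rightarrow> bool" where
  "iso_map L \<M> \<N> f \<longleftrightarrow> partial_iso L \<M> \<N> (univ \<M>) f \<and> f ` univ \<M> = univ \<N>"

definition isomorphic :: "'r language \<Rightarrow> ('r, 'a) struct \<Rightarrow> ('r, 'b) struct \<Rightarrow> bool" where
  "isomorphic L \<M> \<N> \<longleftrightarrow> (\<exists>f. iso_map L \<M> \<N> f)"

definition ultrahomogeneous :: "'r language \<Rightarrow> ('r, 'a) struct \<Rightarrow> bool" where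
  "ultrahomogeneous L \<M> \<longleftrightarrow>
     (\<forall>A f. finite A \<and> partial_iso L \<M> \<M> A f \<longrightarrow>
        (\<exists>g. iso_map L \<M> \<M> g \<and> (\<forall>x\<in>A. g x = f x)))"

definition substructure :: "'r language \<Rightarrow> ('r, 'a) struct \<Rightarrow> ('r, 'a) struct \<Rightarrow> bool" where
  "substructure L \<N> \<M> \<longleftrightarrow>
     univ \<N> \<subseteq> univ \<M> \<and>
     (\<forall>R xs. set xs \<subseteq> univ \<N> \<and> L R = Some (length xs) \<longrightarrow> (rel \<N> R xs \<longleftrightarrow> rel \<M> R xs))"

definition elem_substructure :: "'r language \<Rightarrow> ('r, 'a) struct \<Rightarrow> ('r, 'a) struct \<Rightarrow> bool" where
  "elem_substructure L \<N> \<M> \<longleftrightarrow>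
     substructure L \<N> \<M> \<and>
     (\<forall>\<phi> e. wf_fm L \<phi> \<and> range e \<subseteq> univ \<N> \<longrightarrow> (sat \<N> e \<phi> \<longleftrightarrow> sat \<M> e \<phi>))"

definition monochromatic :: "('a \<Rightarrow> bool) \<Rightarrow> 'a set \<Rightarrow> bool" where
  "monochromatic c A \<longleftrightarrow> (\<exists>i. \<forall>x\<in>A. c x = i)"

definition indivisible :: "'r language \<Rightarrow> ('r, 'a) struct \<Rightarrow> bool" where
  "indivisible L \<M> \<longleftrightarrow>
     (\<forall>c. \<exists>\<M>'. substructure L \<M>' \<M> \<and> monochromatic c (univ \<M>') \<and> isomorphic L \<M>' \<M>)"

definition elementarily_indivisible :: "'r language \<Rightarrow> ('r, 'a) struct \<Rightarrow> bool" where
  "elementarily_indivisible L \<M> \<longleftrightarrow>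
     (\<forall>c. \<exists>\<M>'. elem_substructure L \<M>' \<M> \<and> monochromatic c (univ \<M>') \<and> isomorphic L \<M>' \<M>)"

section \<open>Ordinals\<close>

text \<open>Order types of well-orders whose field is a subset of the type \<open>'a\<close>.\<close>

quotient_type 'a ordinal = "'a rel" / partial: "\<lambda>r s. (r, s) \<in> ordIso"
  morphisms rep_ordinal order_type
proof (rule part_equivpI)
  have "Well_order ({} :: 'a rel)"
    by (simp add: order_on_defs refl_on_def total_on_def)
  then show "\<exists>x :: 'a rel. (x, x) \<in> ordIso"
    by (blast dest: ordIso_reflexive)
  show "symp (\<lambda>(r :: 'a rel) s. (r, s) \<in> ordIso)"
    by (rule sympI) (rule ordIso_symmetric)
  show "transp (\<lambda>(r :: 'a rel) s. (r, s) \<in> ordIso)"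
    by (rule transpI) (rule ordIso_transitive)
qed

instantiation ordinal :: (type) "{linorder, one}"
begin

lift_definition less_eq_ordinal :: "'a ordinal \<Rightarrow> 'a ordinal \<Rightarrow> bool" is "\<lambda>r s. (r, s) \<in> ordLeq"
proof (rule iffI)
  fix r r' s s' :: "'a rel"
  assume *: "(r, r') \<in> ordIso" "(s, s') \<in> ordIso"
  show "(r', s') \<in> ordLeq" if "(r, s) \<in> ordLeq"
    using ordIso_ordLeq_trans[OF ordIso_symmetric[OF *(1)] ordLeq_ordIso_trans[OF that *(2)]] .
  show "(r, s) \<in> ordLeq" if "(r', s') \<in> ordLeq"
    using ordIso_ordLeq_trans[OF *(1) ordLeq_ordIso_trans[OF that ordIso_symmetric[OF *(2)]]] .
qed

lift_definition less_ordinal :: "'a ordinal \<Rightarrow> 'a ordinal \<Rightarrow> bool" is "\<lambda>r s. (r, s) \<in> ordLess"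
proof (rule iffI)
  fix r r' s s' :: "'a rel"
  assume *: "(r, r') \<in> ordIso" "(s, s') \<in> ordIso"
  show "(r', s') \<in> ordLess" if "(r, s) \<in> ordLess"
    using ordIso_ordLess_trans[OF ordIso_symmetric[OF *(1)] ordLess_ordIso_trans[OF that *(2)]] .
  show "(r, s) \<in> ordLess" if "(r', s') \<in> ordLess"
    using ordIso_ordLess_trans[OF *(1) ordLess_ordIso_trans[OF that ordIso_symmetric[OF *(2)]]] .
qed

lift_definition one_ordinal :: "'a ordinal" is "{(undefined, undefined)}"
proof (rule ordIso_reflexive)
  show "Well_order {(undefined :: 'a, undefined)}"
    by (simp add: order_on_defs refl_on_def total_on_def trans_def antisym_def Field_def Diff_insert_absorb)
qed

instance
proof
  have wo: "Well_order r" if "(r, r) \<in> ordIso" for r :: "'a rel"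
    using that by (simp add: ordIso_def)
  fix x y z :: "'a ordinal"
  show "x < y \<longleftrightarrow> x \<le> y \<and> \<not> y \<le> x"
  proof transfer
    fix r s :: "'a rel"
    assume "(r, r) \<in> ordIso" "(s, s) \<in> ordIso"
    then show "(r, s) \<in> ordLess \<longleftrightarrow> (r, s) \<in> ordLeq \<and> (s, r) \<notin> ordLeq"
      using not_ordLeq_iff_ordLess[OF wo wo] ordLess_imp_ordLeq by blast
  qed
  show "x \<le> x"
    by transfer (rule ordIso_imp_ordLeq)
  show "x \<le> y \<Longrightarrow> y \<le> z \<Longrightarrow> x \<le> z"
    by transfer (rule ordLeq_transitive)
  show "x \<le> y \<Longrightarrow> y \<le> x \<Longrightarrow> x = y"
    by transfer (simp add: ordIso_iff_ordLeq)
  show "x \<le> y \<or> y \<le> x"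
    by transfer (rule ordLeq_total[OF wo wo])
qed

end

text \<open>The cofinality of \<open>\<alpha>\<close> is the least cardinality of a cofinal subset of \<open>\<alpha>\<close>.\<close>

definition infinite_cofinality :: "'a ordinal \<Rightarrow> bool" where
  "infinite_cofinality \<alpha> \<longleftrightarrow>
     (\<forall>A. A \<subseteq> {..<\<alpha>} \<and> (\<forall>\<beta><\<alpha>. \<exists>\<gamma>\<in>A. \<beta> \<le> \<gamma>) \<longrightarrow> infinite A)"

section \<open>Trees\<close>

text \<open>A tree is given by its reflexive order \<open>r\<close>, its set of nodes being \<open>Field r\<close>;
  \<open>underS r t\<close> and \<open>aboveS r t\<close> are the sets of nodes strictly below and above \<open>t\<close>.\<close>

definition hausdorff_tree :: "'a rel \<Rightarrow> bool" where
  "hausdorff_tree r \<longleftrightarrow>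
     Partial_order r \<and>
     (\<exists>m\<in>Field r. \<forall>t\<in>Field r. (m, t) \<in> r) \<and>
     (\<forall>t\<in>Field r. well_order_on (underS r t) (Restr r (underS r t))) \<and>
     (\<forall>a\<in>Field r. \<forall>b\<in>Field r. a \<noteq> b \<longrightarrow>
        (\<exists>m. (m, a) \<in> r \<and> (m, b) \<in> r \<and> (\<forall>u. (u, a) \<in> r \<and> (u, b) \<in> r \<longrightarrow> (u, m) \<in> r)))"

definition height :: "'a rel \<Rightarrow> 'a \<Rightarrow> 'a ordinal" where
  "height r t = order_type (Restr r (underS r t))"

definition suc :: "'a rel \<Rightarrow> 'a \<Rightarrow> 'a set" where
  "suc r t = {s \<in> aboveS r t. aboveS r t \<inter> underS r s = {}}"

definition branch :: "'a rel \<Rightarrow> 'a set set" where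
  "branch r = {b \<in> Chains r. \<forall>c\<in>Chains r. b \<subseteq> c \<longrightarrow> c = b}"

definition branch_height :: "'a rel \<Rightarrow> 'a set \<Rightarrow> 'a ordinal" where
  "branch_height r b = order_type (Restr r b)"

definition leveled :: "'a rel \<Rightarrow> bool" where
  "leveled r \<longleftrightarrow> (\<forall>b\<in>branch r. \<forall>c\<in>branch r. branch_height r b = branch_height r c)"

text \<open>For leveled trees: the common height of the branches.\<close>

definition tree_height :: "'a rel \<Rightarrow> 'a ordinal" where
  "tree_height r = (THE \<alpha>. \<forall>b\<in>branch r. branch_height r b = \<alpha>)"

definition branch_succ :: "'a rel \<Rightarrow> 'a set \<Rightarrow> 'a \<Rightarrow> 'a" where
  "branch_succ r b t = (THE s. s \<in> b \<inter> aboveS r t \<and> (\<forall>u\<in>b \<inter> aboveS r t. (s, u) \<in> r))"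

definition is_greatest :: "'a rel \<Rightarrow> 'a set \<Rightarrow> 'a \<Rightarrow> bool" where
  "is_greatest r A m \<longleftrightarrow> m \<in> A \<and> (\<forall>u\<in>A. (u, m) \<in> r)"

text \<open>The height of \<open>a \<and> b\<close>, where \<open>a \<and> a\<close> is read as \<open>a\<close> itself.\<close>

definition meet_height :: "'a rel \<Rightarrow> 'a set \<Rightarrow> 'a set \<Rightarrow> 'a ordinal" where
  "meet_height r a b =
     (if a = b then tree_height r else height r (THE m. is_greatest r (a \<inter> b) m))"

section \<open>Family trees and their products\<close>

definition family_tree :: "'a rel \<Rightarrow> ('a \<Rightarrow> ('r, 'a) struct) \<Rightarrow> bool" where
  "family_tree r \<M> \<longleftrightarrow>
     hausdorff_tree r \<and>
     (\<forall>t\<in>Field r. aboveS r t \<noteq> {}) \<and>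
     leveled r \<and>
     infinite_cofinality (tree_height r) \<and>
     (\<forall>t\<in>Field r. univ (\<M> t) = suc r t)"

text \<open>A branch has no greatest element, so \<open>R(a,\<dots>,a)\<close> fails in the product
  for every branch \<open>a\<close>.\<close>

definition product :: "'a rel \<Rightarrow> ('a \<Rightarrow> ('r, 'a) struct) \<Rightarrow> ('r, 'a set) struct" where
  "product r \<M> =
     \<lparr>univ = branch r,
      rel = \<lambda>R as. \<exists>m. is_greatest r (\<Inter>(set as)) m \<and>
                       rel (\<M> m) R (map (\<lambda>a. branch_succ r a m) as)\<rparr>"

datatype ('r, 'o) esym = Old 'r | S 'o

definition expanded_language :: "'a rel \<Rightarrow> 'r language \<Rightarrow> ('r, 'a ordinal) esym language" where
  "expanded_language r L = (\<lambda>q. case q of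
      Old R \<Rightarrow> L R
    | S \<alpha> \<Rightarrow> if 1 \<le> \<alpha> \<and> \<alpha> < tree_height r then Some 2 else None)"

definition product_s ::
    "'a rel \<Rightarrow> ('a \<Rightarrow> ('r, 'a) struct) \<Rightarrow> (('r, 'a ordinal) esym, 'a set) struct" where
  "product_s r \<M> =
     \<lparr>univ = univ (product r \<M>),
      rel = \<lambda>q as. case q of
          Old R \<Rightarrow> rel (product r \<M>) R as
        | S \<alpha> \<Rightarrow> \<alpha> \<le> meet_height r (as ! 0) (as ! 1)\<rparr>"

definition dense_in_tree :: "'a rel \<Rightarrow> ('r, 'a set) struct \<Rightarrow> bool" where
  "dense_in_tree r \<D> \<longleftrightarrow> (\<forall>t\<in>Field r. \<exists>b\<in>univ \<D>. t \<in> b)"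

definition omega_pure :: "'a rel \<Rightarrow> 'r language \<Rightarrow> ('a \<Rightarrow> ('r, 'a) struct) \<Rightarrow> bool" where
  "omega_pure r L \<M> \<longleftrightarrow>
     countable (Field r) \<and> infinite (Field r) \<and>
     (\<forall>t\<in>Field r. countable (univ (\<M> t)) \<and> infinite (univ (\<M> t)) \<and>
        transitive_struct L (\<M> t) \<and> ultrahomogeneous L (\<M> t)) \<and>
     (\<forall>t\<in>Field r. \<forall>u\<in>Field r. height r t = height r u \<longrightarrow> isomorphic L (\<M> t) (\<M> u))"

end

theory Submission
  imports Defs
begin

text \<open>
  A countable leveled tree with infinite branching has height \<open>\<omega>\<close>, so branches are sequences
  of nodes. Call a set \<open>E\<close> of branches full if at every node of a branch in \<open>E\<close> the successors
  lying on branches of \<open>E\<close> form a copy of the structure at that node. By back-and-forth, using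
  ultrahomogeneity and transitivity, any two countable full sets induce isomorphic structures, and
  a full subset of \<open>\<D>\<close> is an elementary substructure. So it suffices to find a full
  set inside one of the two colour classes.

  Call a node red-good if it carries a full set of red branches above it, and likewise for blue;
  let \<open>N\<close> be the set of nodes of neither kind. If every node of \<open>N\<close> could be led to a red-good
  node through copies consisting of nodes of \<open>N\<close> and red-good ones, then \<open>N\<close> would be red-good. So
  the set \<open>Y\<close> of nodes of \<open>N\<close> that cannot is nonempty. Indivisibility gives, whenever a node of
  \<open>Y\<close> has a successor outside \<open>Y\<close>, a copy among its successors that lies in \<open>Y\<close> and the
  blue-good nodes and meets the latter. This makes \<open>Y\<close> blue-good, a contradiction.
\<close>

section \<open>Copies in indivisible structures\<close>

text \<open>The colouring is of branches, whereas indivisibility colours the successors of a node.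
  The colour of a branch is not visible at any of its nodes, and a branch assembled node by node may
  fail to belong to the given countable set. So a node counts as good only if an actual branch of
  the right colour passes through it and stays inside copies made of good nodes; this is a
  coinductive notion. A monochromatic copy could lie entirely among the undecided nodes and give no
  progress. What is used instead is a copy that meets exactly one of two disjoint sets of
  successors. Transitivity enters twice. It supplies the automorphisms behind that copy, and it
  covers what the product forgets: a relation between branches is evaluated where they split, so it
  says nothing about \<open>R(a,...,a)\<close> at a node where all of them take the same successor
  \<open>a\<close>. A map between successor sets has to respect these diagonal atoms too, and all
  points of a transitive structure agree on them.\<close>

definition restrict_struct :: "('r, 'a) struct \<Rightarrow> 'a set \<Rightarrow> ('r, 'a) struct" where
  "restrict_struct K C = K\<lparr>univ := C\<rparr>"

lemma restrict_struct_simps [simp]: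
  "univ (restrict_struct K C) = C" "rel (restrict_struct K C) = rel K"
  by (simp_all add: restrict_struct_def)

definition copy :: "'r language \<Rightarrow> ('r, 'a) struct \<Rightarrow> 'a set \<Rightarrow> bool" where
  "copy L K C \<longleftrightarrow> C \<subseteq> univ K \<and> isomorphic L (restrict_struct K C) K"

lemma partial_isoD:
  assumes "partial_iso L M N A f" "set xs \<subseteq> A" "L R = Some (length xs)"
  shows "rel M R xs \<longleftrightarrow> rel N R (map f xs)"
  using assms unfolding partial_iso_def by blast

lemma partial_iso_comp:
  assumes f: "partial_iso L M N A f" and g: "partial_iso L N P B g" and AB: "f ` A \<subseteq> B"
  shows "partial_iso L M P A (g \<circ> f)"
  unfolding partial_iso_def
proof (intro conjI allI impI)
  show "A \<subseteq> univ M" using f by (simp add: partial_iso_def)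
  show "(g \<circ> f) ` A \<subseteq> univ P" using g AB unfolding partial_iso_def by fastforce
  show "inj_on (g \<circ> f) A"
    using f g AB unfolding partial_iso_def by (meson comp_inj_on inj_on_subset)
  fix R xs assume xs: "set xs \<subseteq> A \<and> L R = Some (length xs)"
  then have "set (map f xs) \<subseteq> B" using AB by auto
  then show "rel M R xs \<longleftrightarrow> rel P R (map (g \<circ> f) xs)"
    using partial_isoD[OF f, of xs R] partial_isoD[OF g, of "map f xs" R] xs by simp
qed

lemma partial_iso_inv:
  assumes f: "partial_iso L M N A f"
  shows "partial_iso L N M (f ` A) (inv_into A f)"
  unfolding partial_iso_def
proof (intro conjI allI impI)
  show "f ` A \<subseteq> univ N" using f by (simp add: partial_iso_def)
  show "inv_into A f ` f ` A \<subseteq> univ M" using f by (auto simp: partial_iso_def)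
  show "inj_on (inv_into A f) (f ` A)" by (simp add: inj_on_inv_into)
  fix R xs assume xs: "set xs \<subseteq> f ` A \<and> L R = Some (length xs)"
  then have "set (map (inv_into A f) xs) \<subseteq> A" by (auto simp: inv_into_into)
  moreover have "map f (map (inv_into A f) xs) = xs"
    using xs by (auto simp: f_inv_into_f subset_iff intro!: map_idI)
  ultimately show "rel N R xs \<longleftrightarrow> rel M R (map (inv_into A f) xs)"
    using partial_isoD[OF f, of "map (inv_into A f) xs" R] xs by simp
qed

lemma partial_iso_subset:
  "partial_iso L M N A f \<Longrightarrow> B \<subseteq> A \<Longrightarrow> partial_iso L M N B f"
  unfolding partial_iso_def by (meson image_mono inj_on_subset order_trans)

lemma iso_map_comp:
  assumes "iso_map L M N f" "iso_map L N P g"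
  shows "iso_map L M P (g \<circ> f)"
  using assms partial_iso_comp[of L M N "univ M" f P "univ N" g]
  unfolding iso_map_def by (metis image_comp order_refl)

lemma iso_map_inv:
  assumes "iso_map L M N f"
  shows "iso_map L N M (inv_into (univ M) f)"
proof -
  have "partial_iso L N M (univ N) (inv_into (univ M) f)"
    using assms partial_iso_inv[of L M N "univ M" f] unfolding iso_map_def by simp
  moreover have "inv_into (univ M) f ` univ N = univ M"
    using assms unfolding iso_map_def partial_iso_def
    by (metis inv_into_image_cancel order_refl)
  ultimately show ?thesis by (simp add: iso_map_def)
qed

lemma isomorphic_sym: "isomorphic L M N \<Longrightarrow> isomorphic L N M"
  using iso_map_inv unfolding isomorphic_def by blast

lemma isomorphic_trans: "isomorphic L M N \<Longrightarrow> isomorphic L N P \<Longrightarrow> isomorphic L M P"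
  using iso_map_comp unfolding isomorphic_def by blast

lemma copy_refl: "copy L K (univ K)"
proof -
  have "iso_map L (restrict_struct K (univ K)) K id"
    by (simp add: iso_map_def partial_iso_def)
  then show ?thesis unfolding copy_def isomorphic_def by blast
qed

lemma copy_nonempty: "copy L K C \<Longrightarrow> univ K \<noteq> {} \<Longrightarrow> C \<noteq> {}"
  unfolding copy_def isomorphic_def iso_map_def by auto

lemma copy_automorphism_image:
  assumes g: "iso_map L K K g" and C: "copy L K C"
  shows "copy L K (g ` C)"
proof -
  have "partial_iso L K K C g"
    using g C unfolding iso_map_def copy_def by (blast intro: partial_iso_subset)
  then have "iso_map L (restrict_struct K C) (restrict_struct K (g ` C)) g"
    by (simp add: iso_map_def partial_iso_def)
  moreover have "g ` C \<subseteq> univ K"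
    using g C unfolding iso_map_def copy_def by auto
  ultimately show ?thesis
    using C unfolding copy_def by (metis isomorphic_def isomorphic_sym isomorphic_trans)
qed

lemma indivisible_copy:
  assumes "indivisible L K"
  obtains C where "copy L K C" "monochromatic c C"
proof -
  obtain M' where M': "substructure L M' K" "monochromatic c (univ M')" "isomorphic L M' K"
    using assms unfolding indivisible_def by blast
  have "iso_map L (restrict_struct K (univ M')) M' id"
    using M'(1) by (auto simp: iso_map_def partial_iso_def substructure_def)
  then have "copy L K (univ M')"
    using M' unfolding copy_def substructure_def by (metis isomorphic_def isomorphic_trans)
  with M'(2) that show thesis by blast
qed

text \<open>Suppose every copy meeting one of \<open>R\<close>, \<open>B\<close> meets both. Cover the universe by
  translates \<open>g\<^sub>i R \<union> g\<^sub>i B\<close> and colour a point by its side in the first translate containing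
  it. In a monochromatic copy, the least translate that it meets gives a contradiction.\<close>

lemma indivisible_copy_meets_one:
  assumes ind: "indivisible L K" and cnt: "countable (univ K)"
    and tr: "\<And>a b. a \<in> univ K \<Longrightarrow> b \<in> univ K \<Longrightarrow> \<exists>g. iso_map L K K g \<and> g a = b"
    and RB: "R \<subseteq> univ K" "B \<subseteq> univ K" "R \<inter> B = {}" "R \<union> B \<noteq> {}"
  shows "\<exists>C. copy L K C \<and> (C \<inter> R \<noteq> {}) \<noteq> (C \<inter> B \<noteq> {})"
proof (rule ccontr)
  assume "\<not> ?thesis"
  then have both: "C \<inter> R \<noteq> {} \<longleftrightarrow> C \<inter> B \<noteq> {}" if "copy L K C" for C
    using that by blast
  \<comment> \<open>The universe itself is a copy; it meets \<open>R\<close> or \<open>B\<close>,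
    hence both.\<close>
  obtain r0 where r0: "r0 \<in> R"
    using both[OF copy_refl] RB by blast
  then have ne: "univ K \<noteq> {}" using RB by blast
  define en where "en = from_nat_into (univ K)"
  have en: "range en = univ K" unfolding en_def by (rule range_from_nat_into[OF ne cnt])
  have "\<forall>i. \<exists>g. iso_map L K K g \<and> g r0 = en i"
    using tr r0 RB(1) en by blast
  then obtain g where g: "\<And>i. iso_map L K K (g i)" "\<And>i. g i r0 = en i" by metis
  define idx where "idx y = (LEAST i. y \<in> g i ` (R \<union> B))" for y
  have idx: "y \<in> g (idx y) ` (R \<union> B)" if y: "y \<in> univ K" for y
  proof -
    obtain i where "y = en i" using y en by blast
    then have "y \<in> g i ` (R \<union> B)" using g(2)[of i] r0 by force
    then show ?thesis unfolding idx_def by (rule LeastI)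
  qed
  define c where "c y \<longleftrightarrow> y \<in> g (idx y) ` R" for y
  obtain C where C: "copy L K C" "monochromatic c C"
    using indivisible_copy[OF ind] .
  have CK: "C \<subseteq> univ K" using C(1) by (simp add: copy_def)
  have "C \<noteq> {}" using copy_nonempty[OF C(1) ne] .
  then obtain y where y: "y \<in> C" "\<And>z. z \<in> C \<Longrightarrow> idx y \<le> idx z"
    using ex_has_least_nat[of "\<lambda>z. z \<in> C" _ idx] by blast
  define h where "h = g (idx y)"
  have h: "iso_map L K K h" "inj_on h (univ K)" "h ` univ K = univ K"
    using g(1)[of "idx y"] by (simp_all add: h_def iso_map_def partial_iso_def)
  \<comment> \<open>Pulling back along \<open>h\<close> moves the least translate met by
    \<open>C\<close> to \<open>R \<union> B\<close> itself, where \<open>both\<close>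
    applies.\<close>
  define C' where "C' = inv_into (univ K) h ` C"
  have C': "copy L K C'"
    unfolding C'_def by (rule copy_automorphism_image[OF iso_map_inv[OF h(1)] C(1)])
  have hC': "h ` C' = C"
    unfolding C'_def using CK h(3) by (simp add: image_inv_into_cancel)
  have C'K: "C' \<subseteq> univ K" using C' by (simp add: copy_def)
  obtain x where x: "x \<in> R \<union> B" "y = h x"
    using idx[of y] y(1) CK unfolding h_def by blast
  have "x \<in> C'"
  proof -
    obtain x' where "x' \<in> C'" "h x' = y" using hC' y(1) by blast
    moreover have "x = x'"
      using inj_onD[OF h(2), of x x'] calculation x C'K RB by auto
    ultimately show ?thesis by simp
  qed
  then have "C' \<inter> R \<noteq> {}" "C' \<inter> B \<noteq> {}" using both[OF C'] x(1) by blast+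
  then obtain u v where uv: "u \<in> C'" "u \<in> R" "v \<in> C'" "v \<in> B" by blast
  have huv: "h u \<in> C" "h v \<in> C" using uv hC' by blast+
  \<comment> \<open>At most, because the translate with index \<open>idx y\<close> contains
    \<open>z\<close>; at least, because \<open>y\<close> has the least index in
    \<open>C\<close>.\<close>
  have eq: "idx z = idx y" if "z \<in> C" "z \<in> h ` (R \<union> B)" for z
  proof -
    have "idx z \<le> idx y" using that(2) unfolding idx_def[of z] h_def by (rule Least_le)
    with y(2)[OF that(1)] show ?thesis by simp
  qed
  have "c (h u)" using eq[of "h u"] huv uv unfolding c_def by (auto simp: h_def[symmetric])
  moreover have "\<not> c (h v)"
  proof
    assume "c (h v)"
    then have "h v \<in> h ` R"
      using eq[of "h v"] huv uv unfolding c_def by (auto simp: h_def[symmetric])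
    then show False using inj_onD[OF h(2)] uv RB by blast
  qed
  ultimately show False using C(2) huv unfolding monochromatic_def by metis
qed

section \<open>From a unique 1-type to automorphisms\<close>

lemma sat_transport:
  assumes "inj_on f (univ M)" and "univ N = f ` univ M"
    and "\<And>R xs. set xs \<subseteq> univ M \<Longrightarrow> rel N R (map f xs) \<longleftrightarrow> rel M R xs"
    and "range e \<subseteq> univ M"
  shows "sat N (f \<circ> e) \<phi> \<longleftrightarrow> sat M e \<phi>"
  using assms(4)
proof (induction \<phi> arbitrary: e)
  case (Eq i j)
  then show ?case using assms(1) by (auto simp: inj_on_eq_iff image_subset_iff)
next
  case (Rel R xs)
  then have "set (map e xs) \<subseteq> univ M" by auto
  from assms(3)[OF this, of R] show ?case by (simp add: comp_def)
next
  case (Exi i \<phi>)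
  have "sat N ((f \<circ> e)(i := f a)) \<phi> \<longleftrightarrow> sat M (e(i := a)) \<phi>" if "a \<in> univ M" for a
  proof -
    have "range (e(i := a)) \<subseteq> univ M" using Exi.prems that by auto
    from Exi.IH[OF this] show ?thesis by (metis fun_upd_comp)
  qed
  then show ?case unfolding sat.simps assms(2) bex_simps(7) by blast
qed auto

text \<open>The atom \<open>R(x,...,x)\<close> is a formula in one variable, and each point realises
  a complete 1-type of the theory. As \<open>complete_1type\<close> admits only models whose
  elements are formulas, the countable universe is recoded by the equations
  \<open>Eq 0 n\<close>.\<close>

lemma transitive_struct_same_diagonal:
  fixes K :: "('r, 'a) struct"
  assumes tr: "transitive_struct L K" and cnt: "countable (univ K)"
    and ab: "a \<in> univ K" "b \<in> univ K" and R: "L R = Some n"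
  shows "rel K R (replicate n a) \<longleftrightarrow> rel K R (replicate n b)"
proof -
  define p where "p x = {\<phi>. wf_fm L \<phi> \<and> fv \<phi> \<subseteq> {0} \<and> sat K (\<lambda>_. x) \<phi>}" for x
  define f :: "'a \<Rightarrow> 'r fm" where "f x = Eq 0 (to_nat_on (univ K) x)" for x
  have inj: "inj_on f (univ K)"
    using inj_on_to_nat_on[OF cnt] by (auto simp: f_def inj_on_def)
  define N :: "('r, 'r fm) struct" where
    "N = \<lparr>univ = f ` univ K, rel = \<lambda>R xs. rel K R (map (inv_into (univ K) f) xs)\<rparr>"
  have sat: "sat N (f \<circ> e) \<phi> \<longleftrightarrow> sat K e \<phi>" if "range e \<subseteq> univ K" for e \<phi>
  proof (rule sat_transport[OF inj _ _ that])
    fix R xs assume "set xs \<subseteq> univ K"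
    then have "map (inv_into (univ K) f) (map f xs) = xs"
      using inj by (auto intro!: map_idI)
    then show "rel N R (map f xs) \<longleftrightarrow> rel K R xs" by (simp add: N_def)
  qed (simp add: N_def)
  have Th: "models N \<phi>" if "\<phi> \<in> Th L K" for \<phi>
    unfolding models_def
  proof (intro allI impI)
    fix e :: "nat \<Rightarrow> 'r fm" assume e: "range e \<subseteq> univ N"
    define e' where "e' = inv_into (univ K) f \<circ> e"
    have "range e' \<subseteq> univ K" using e by (auto simp: e'_def N_def inv_into_into image_subset_iff)
    moreover have "f \<circ> e' = e"
      using e by (auto simp: e'_def N_def fun_eq_iff f_inv_into_f image_subset_iff)
    ultimately show "sat N e \<phi>"
      using sat[of e' \<phi>] that by (auto simp: Th_def models_def)
  qed
  have "complete_1type L (Th L K) (p x)" if x: "x \<in> univ K" for x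
    unfolding complete_1type_def
  proof (intro conjI exI[of _ N] exI[of _ "f x"] ballI)
    show "f x \<in> univ N" using x by (simp add: N_def)
    show "sat N (\<lambda>_. f x) \<phi>" if "\<phi> \<in> p x" for \<phi>
      using sat[of "\<lambda>_. x" \<phi>] that x by (simp add: p_def comp_def)
  qed (auto simp: p_def Th)
  then have "p a = p b" using tr ab unfolding transitive_struct_def by blast
  moreover have "Rel R (replicate n 0) \<in> p x \<longleftrightarrow> rel K R (replicate n x)" for x
    using R by (auto simp: p_def map_replicate_const)
  ultimately show ?thesis by metis
qed

text \<open>The only atoms on a one-point set are the diagonal ones, so any map between two points
  is a partial isomorphism and extends.\<close>

lemma transitive_ultrahomogeneous_automorphism:
  assumes "transitive_struct L K" "ultrahomogeneous L K" "countable (univ K)"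
    and ab: "a \<in> univ K" "b \<in> univ K"
  shows "\<exists>g. iso_map L K K g \<and> g a = b"
proof -
  have "partial_iso L K K {a} (\<lambda>_. b)"
    unfolding partial_iso_def
  proof (intro conjI allI impI)
    fix R xs assume xs: "set xs \<subseteq> {a} \<and> L R = Some (length xs)"
    then have "xs = replicate (length xs) a"
      by (metis replicate_eqI singletonD subsetD)
    then show "rel K R xs \<longleftrightarrow> rel K R (map (\<lambda>_. b) xs)"
      using transitive_struct_same_diagonal[OF assms(1,3) ab, of R "length xs"] xs
      by (simp add: map_replicate_const)
  qed (use ab in auto)
  then show ?thesis using assms(2) unfolding ultrahomogeneous_def by (meson finite.simps singletonI)
qed

section \<open>Full sets in a colour class\<close>

text \<open>Keeps of the tree only the sequences of nodes along the given branches.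
  \<open>nd_dense\<close> is density, one successor at a time; no axiom makes a coherent sequence of
  nodes come from a branch in \<open>D\<close>.\<close>

locale branch_family =
  fixes sc :: "'a \<Rightarrow> 'a set" and D :: "'b set" and nd :: "'b \<Rightarrow> nat \<Rightarrow> 'a"
  assumes nonempty: "D \<noteq> {}"
    and nd_0: "a \<in> D \<Longrightarrow> b \<in> D \<Longrightarrow> nd a 0 = nd b 0"
    and nd_Suc: "b \<in> D \<Longrightarrow> nd b (Suc n) \<in> sc (nd b n)"
    and nd_level: "a \<in> D \<Longrightarrow> b \<in> D \<Longrightarrow> nd a m = nd b n \<Longrightarrow> m = n"
    and nd_back: "a \<in> D \<Longrightarrow> b \<in> D \<Longrightarrow> nd a (Suc n) = nd b (Suc n) \<Longrightarrow> nd a n = nd b n"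
    and nd_dense: "b \<in> D \<Longrightarrow> x \<in> sc (nd b n) \<Longrightarrow> \<exists>c\<in>D. nd c n = nd b n \<and> nd c (Suc n) = x"
    and nd_eqI: "a \<in> D \<Longrightarrow> b \<in> D \<Longrightarrow> (\<And>n. nd a n = nd b n) \<Longrightarrow> a = b"
begin

definition V :: "'a set" where "V = {nd b n |b n. b \<in> D}"

definition succs :: "'b set \<Rightarrow> 'b \<Rightarrow> nat \<Rightarrow> 'a set" where
  "succs E b n = {nd c (Suc n) |c. c \<in> E \<and> nd c n = nd b n}"

lemma nd_V: "b \<in> D \<Longrightarrow> nd b n \<in> V"
  by (auto simp: V_def)

lemma nd_agree:
  assumes "a \<in> D" "b \<in> D" "m \<le> n" "nd a n = nd b n"
  shows "nd a m = nd b m"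
  using assms(3,4)
proof (induction rule: dec_induct)
  case (step k)
  then show ?case using nd_back[OF assms(1,2)] by blast
qed

lemma sc_V: "t \<in> V \<Longrightarrow> sc t \<subseteq> V"
proof
  fix x assume t: "t \<in> V" and x: "x \<in> sc t"
  then obtain b n where "b \<in> D" "t = nd b n" by (auto simp: V_def)
  then show "x \<in> V" using nd_dense[of b x n] x nd_V by auto
qed

lemma succs_D:
  assumes "b \<in> D"
  shows "succs D b n = sc (nd b n)"
proof
  show "succs D b n \<subseteq> sc (nd b n)"
  proof
    fix x assume "x \<in> succs D b n"
    then obtain c where c: "c \<in> D" "nd c n = nd b n" "x = nd c (Suc n)" by (auto simp: succs_def)
    then show "x \<in> sc (nd b n)" using nd_Suc[of c n] by simp
  qed
  show "sc (nd b n) \<subseteq> succs D b n"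
    using nd_dense[OF assms] unfolding succs_def by blast
qed

end

section \<open>Good nodes for a set of branches\<close>

locale branch_family_copies = branch_family sc D nd
  for sc :: "'a \<Rightarrow> 'a set" and D :: "'b set" and nd :: "'b \<Rightarrow> nat \<Rightarrow> 'a" +
  fixes cp :: "'a \<Rightarrow> 'a set \<Rightarrow> bool"
  assumes cp_sc: "t \<in> V \<Longrightarrow> cp t C \<Longrightarrow> C \<subseteq> sc t"
    and cp_full: "t \<in> V \<Longrightarrow> cp t (sc t)"
    and cp_meets_one: "t \<in> V \<Longrightarrow> R \<subseteq> sc t \<Longrightarrow> B \<subseteq> sc t \<Longrightarrow> R \<inter> B = {} \<Longrightarrow> R \<union> B \<noteq> {} \<Longrightarrow>
      \<exists>C. cp t C \<and> (C \<inter> R \<noteq> {}) \<noteq> (C \<inter> B \<noteq> {})"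
begin

text \<open>The witness is a single branch that really belongs to \<open>X\<close>; the other
  members of the copies along it must find witnesses of their own. Only nodes after \<open>t\<close>
  are constrained, so \<open>t\<close> may lie outside \<open>W\<close>.\<close>

definition reach :: "'b set \<Rightarrow> 'a set \<Rightarrow> 'a \<Rightarrow> bool" where
  "reach X W t \<longleftrightarrow> (\<exists>b\<in>X. \<exists>n. nd b n = t \<and>
     (\<forall>m\<ge>n. \<exists>C. cp (nd b m) C \<and> nd b (Suc m) \<in> C \<and> C \<subseteq> W))"

definition sound :: "'b set \<Rightarrow> 'a set \<Rightarrow> bool" where
  "sound X W \<longleftrightarrow> (\<forall>t\<in>W. reach X W t)"

text \<open>The greatest fixed point of the monotone operator taking \<open>W\<close> to the nodes
  \<open>t\<close> with \<open>reach X W t\<close>, as the union of its post-fixed points. The least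
  fixed point is empty, since \<open>reach X {} t\<close> never holds.\<close>

definition good :: "'b set \<Rightarrow> 'a set" where
  "good X = \<Union>{W. sound X W}"

lemma reach_mono: "reach X W t \<Longrightarrow> W \<subseteq> W' \<Longrightarrow> reach X W' t"
  unfolding reach_def by (meson order_trans)

lemma sound_good: "sound X (good X)"
  unfolding sound_def
proof
  fix t assume "t \<in> good X"
  then obtain W where W: "sound X W" "t \<in> W" by (auto simp: good_def)
  then have "W \<subseteq> good X" by (auto simp: good_def)
  with W show "reach X (good X) t" using reach_mono by (auto simp: sound_def)
qed

lemma sound_imp_good: "sound X W \<Longrightarrow> W \<subseteq> good X"
  by (auto simp: good_def)

lemma reach_good: "t \<in> good X \<Longrightarrow> good X \<subseteq> W \<Longrightarrow> reach X W t"
  using sound_good reach_mono unfolding sound_def by blast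

text \<open>Predecessors are unique, so the branch witnessing \<open>x\<close> already runs through
  \<open>t\<close>; the copy \<open>C\<close> serves at that one additional level.\<close>

lemma reach_step:
  assumes X: "X \<subseteq> D" and t: "t \<in> V" and C: "cp t C" "C \<subseteq> W" and x: "x \<in> C" "reach X W x"
  shows "reach X W t"
proof -
  obtain b n where b: "b \<in> X" "nd b n = x"
    and bC: "\<And>m. n \<le> m \<Longrightarrow> \<exists>C. cp (nd b m) C \<and> nd b (Suc m) \<in> C \<and> C \<subseteq> W"
    using x(2) unfolding reach_def by blast
  obtain a k where a: "a \<in> D" "t = nd a k" using t unfolding V_def by blast
  have "x \<in> sc (nd a k)" using cp_sc[OF t C(1)] x(1) a by blast
  then obtain c where c: "c \<in> D" "nd c k = t" "nd c (Suc k) = x"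
    using nd_dense a by metis
  have bD: "b \<in> D" using b X by blast
  have n: "n = Suc k" using nd_level[OF bD c(1)] b(2) c(3) by simp
  then have bk: "nd b k = t" using nd_back[OF bD c(1), of k] b(2) c by simp
  show ?thesis unfolding reach_def
  proof (intro bexI[OF _ b(1)] exI[of _ k] conjI allI impI bk)
    fix m assume "k \<le> m"
    then show "\<exists>C. cp (nd b m) C \<and> nd b (Suc m) \<in> C \<and> C \<subseteq> W"
      using bC[of m] C x(1) b(2) n bk by (cases "m = k") auto
  qed
qed

text \<open>Every node \<open>t\<close> of the sound set owns a branch \<open>f t\<close> and copies \<open>C t m\<close> along it. A
  branch follows the branch of its current owner until it leaves it at some node, which
  becomes the new owner.\<close>

lemma sound_imp_full_subset:
  assumes X: "X \<subseteq> D" and W: "sound X W" and root: "b0 \<in> D" "nd b0 0 \<in> W"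
  shows "\<exists>E\<subseteq>X. E \<noteq> {} \<and> (\<forall>b\<in>E. \<forall>n. cp (nd b n) (succs E b n))"
proof -
  have "\<forall>t\<in>W. \<exists>b n C. b \<in> X \<and> nd b n = t \<and>
     (\<forall>m\<ge>n. cp (nd b m) (C m) \<and> nd b (Suc m) \<in> C m \<and> C m \<subseteq> W)"
    using W unfolding sound_def reach_def by metis
  then obtain f lv C where f: "\<And>t. t \<in> W \<Longrightarrow> f t \<in> X" "\<And>t. t \<in> W \<Longrightarrow> nd (f t) (lv t) = t"
    and C: "\<And>t m. t \<in> W \<Longrightarrow> lv t \<le> m \<Longrightarrow>
      cp (nd (f t) m) (C t m) \<and> nd (f t) (Suc m) \<in> C t m \<and> C t m \<subseteq> W"
    by metis
  define r where "r = nd b0 0"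
  have rW: "r \<in> W" and fD: "\<And>t. t \<in> W \<Longrightarrow> f t \<in> D" using root f(1) X by (auto simp: r_def)
  have lv: "lv (nd b n) = n" if "b \<in> D" "nd b n \<in> W" for b n
    using nd_level[OF fD[OF that(2)] that(1) f(2)[OF that(2)]] .
  define ow where "ow b = rec_nat r (\<lambda>n t. if nd b (Suc n) = nd (f t) (Suc n) then t else nd b (Suc n))"
    for b
  have ow_0: "ow b 0 = r"
    and ow_Suc: "ow b (Suc n) = (if nd b (Suc n) = nd (f (ow b n)) (Suc n) then ow b n else nd b (Suc n))"
    for b n by (simp_all add: ow_def)
  \<comment> \<open>Ownership depends on the node alone, so all branches through a node are bound by
    the same copy there.\<close>
  have ow_agree: "ow a n = ow b n" if "a \<in> D" "b \<in> D" "nd a n = nd b n" for a b n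
    using that(3)
  proof (induction n)
    case (Suc n)
    then show ?case using nd_back[OF that(1,2)] by (simp add: ow_Suc)
  qed (simp add: ow_0)
  define ok where "ok b n \<longleftrightarrow> nd b (Suc n) \<in> C (ow b n) n" for b n
  have inv: "ow b n \<in> W \<and> lv (ow b n) \<le> n \<and> nd (f (ow b n)) n = nd b n"
    if "b \<in> D" "\<And>m. m < n \<Longrightarrow> ok b m" for b n
    using that(2)
  proof (induction n)
    case 0
    have "lv r = 0" using lv[OF root(1), of 0] root by (simp add: r_def)
    then show ?case using rW nd_0[OF fD[OF rW] that(1)] by (simp add: ow_0)
  next
    case (Suc n)
    then have IH: "ow b n \<in> W" "lv (ow b n) \<le> n" "nd (f (ow b n)) n = nd b n" by auto
    have "nd b (Suc n) \<in> W"
      using Suc.prems[of n] C[OF IH(1,2)] by (auto simp: ok_def)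
    then show ?case using IH lv[OF that(1)] f(2)[of "nd b (Suc n)"] by (simp add: ow_Suc)
  qed
  define E where "E = {b \<in> X. \<forall>n. ok b n}"
  \<comment> \<open>Once \<open>t\<close> owns its branch \<open>f t\<close> it owns it forever, and
    \<open>C t\<close> contains all later nodes; only the levels below \<open>n\<close> need
    checking.\<close>
  have follow: "f t \<in> E" if t: "t \<in> W" "ow (f t) n = t" "lv t \<le> n" "\<And>m. m < n \<Longrightarrow> ok (f t) m" for t n
  proof -
    have "ow (f t) m = t" if "n \<le> m" for m
      using that by (induction rule: dec_induct) (simp_all add: t(2) ow_Suc)
    then have "ok (f t) m" if "n \<le> m" for m
      using C[OF t(1), of m] that t(3) by (simp add: ok_def)
    then have "ok (f t) m" for m using t(4) by (meson not_le)
    then show ?thesis using f(1)[OF t(1)] unfolding E_def by blast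
  qed
  have "f r \<in> E"
    using follow[OF rW, of 0] lv[OF root(1), of 0] root by (simp add: ow_0 r_def)
  moreover have "cp (nd b n) (succs E b n)" if b: "b \<in> E" for b n
  proof -
    have bD: "b \<in> D" and ok: "\<And>m. ok b m" using b X by (auto simp: E_def)
    define t where "t = ow b n"
    have t: "t \<in> W" "lv t \<le> n" "nd (f t) n = nd b n" using inv[OF bD ok] by (auto simp: t_def)
    have okagree: "ok c m" if "c \<in> D" "nd c n = nd b n" "m < n" for c m
    proof -
      have "nd c m = nd b m" "nd c (Suc m) = nd b (Suc m)"
        using nd_agree[OF that(1) bD _ that(2)] that(3) by auto
      then show ?thesis using ok[of m] ow_agree[OF that(1) bD] by (simp add: ok_def)
    qed
    \<comment> \<open>The successor on the owner's branch is realised by \<open>f t\<close>. Any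
      other \<open>x\<close> in the copy is realised by its own branch \<open>f x\<close>, which
      passes to the owner \<open>x\<close> at the next level.\<close>
    have "succs E b n = C t n"
    proof (intro equalityI subsetI)
      fix x assume "x \<in> succs E b n"
      then obtain c where c: "c \<in> E" "nd c n = nd b n" "x = nd c (Suc n)"
        unfolding succs_def by blast
      then have "ok c n" "c \<in> D" using X by (auto simp: E_def)
      then show "x \<in> C t n" using ow_agree[OF _ bD c(2)] c by (simp add: ok_def t_def)
    next
      fix x assume x: "x \<in> C t n"
      show "x \<in> succs E b n"
      proof (cases "x = nd (f t) (Suc n)")
        case True
        have "f t \<in> E"
          using follow[OF t(1) _ t(2)] okagree[OF fD[OF t(1)] t(3)]
            ow_agree[OF fD[OF t(1)] bD t(3)] by (simp add: t_def)
        then show ?thesis using True t(3) unfolding succs_def by blast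
      next
        case False
        have xW: "x \<in> W" using C[OF t(1,2)] x by blast
        have cpt: "cp (nd b n) (C t n)" using C[OF t(1,2)] t(3) by simp
        have "x \<in> sc (nd b n)"
          using x cp_sc[OF nd_V[OF bD] cpt] by blast
        then obtain c where c: "c \<in> D" "nd c n = nd b n" "nd c (Suc n) = x"
          using nd_dense[OF bD] by blast
        have lvx: "lv x = Suc n" using lv[OF c(1), of "Suc n"] c(3) xW by simp
        then have fx: "nd (f x) (Suc n) = x" using f(2)[OF xW] by simp
        then have fxn: "nd (f x) n = nd b n" using nd_back[OF fD[OF xW] c(1), of n] c by simp
        have own: "ow (f x) n = t" using ow_agree[OF fD[OF xW] bD fxn] by (simp add: t_def)
        have "f x \<in> E"
        proof (rule follow[OF xW, of "Suc n"])
          show "ow (f x) (Suc n) = x" using own fx False by (simp add: ow_Suc)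
          show "ok (f x) m" if "m < Suc n" for m
            using okagree[OF fD[OF xW] fxn, of m] that x own fx
            by (cases "m = n") (auto simp: ok_def)
        qed (simp add: lvx)
        then show ?thesis using fxn fx unfolding succs_def by (intro CollectI exI[of _ "f x"]) simp
      qed
    qed
    then show ?thesis using C[OF t(1,2)] t(3) by simp
  qed
  ultimately show ?thesis by (intro exI[of _ E]) (auto simp: E_def)
qed

text \<open>\<open>Z\<close> is the obstruction to \<open>Y\<close> being good for
  \<open>D - X\<close>. It is closed under successors. If every node of \<open>Z\<close> lies on a
  branch in \<open>X\<close>, then \<open>Z\<close> is sound for \<open>X\<close>; otherwise the
  cone above some node of \<open>Z\<close> contains no branch in \<open>X\<close> and is sound for
  \<open>D - X\<close>. Both contradict that nodes of \<open>Z\<close> are good on neither side, so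
  \<open>Z\<close> is empty.\<close>

lemma V_subset_good:
  assumes X: "X \<subseteq> D"
  shows "V \<subseteq> good X \<union> good (D - X)"
proof (rule ccontr)
  define R B N Y Z where "R = good X" and "B = good (D - X)" and "N = V - (R \<union> B)"
    and "Y = {t \<in> N. \<not> reach X (N \<union> R) t}" and "Z = {t \<in> Y. \<not> reach (D - X) (Y \<union> B) t}"
  assume "\<not> V \<subseteq> good X \<union> good (D - X)"
  then have N: "N \<noteq> {}" by (auto simp: N_def R_def B_def)
  have DX: "D - X \<subseteq> D" by blast
  have Rr: "reach X (N \<union> R) t" if "t \<in> R" for t
    using reach_good that by (auto simp: R_def)
  have Br: "reach (D - X) (Y \<union> B) t" if "t \<in> B" for t
    using reach_good that by (auto simp: B_def)
  have Y: "Y \<noteq> {}"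
  proof
    assume "Y = {}"
    then have "sound X (N \<union> R)" using Rr by (auto simp: sound_def Y_def)
    then have "N \<subseteq> R" using sound_imp_good by (auto simp: R_def)
    then show False using N by (auto simp: N_def)
  qed
  have Ystep: "sc t \<subseteq> Y \<or> (\<exists>C. cp t C \<and> C \<subseteq> Y \<union> B \<and> C \<inter> B \<noteq> {})" if t: "t \<in> Y" for t
  proof (cases "sc t \<subseteq> Y")
    case False
    have tV: "t \<in> V" using t by (auto simp: Y_def N_def)
    \<comment> \<open>Removing \<open>Y\<close> from one side and \<open>R\<close> from the other
      makes the sides disjoint; with \<open>Y\<close> they still cover all successors.\<close>
    define R' B' where "R' = sc t \<inter> ((N \<union> R) - Y)" and "B' = sc t \<inter> (B - R)"
    have cover: "sc t \<subseteq> Y \<union> R' \<union> B'"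
      using sc_V[OF tV] by (auto simp: R'_def B'_def N_def)
    have "R' \<inter> B' = {}" by (auto simp: R'_def B'_def N_def)
    moreover have "R' \<union> B' \<noteq> {}" using False cover by blast
    ultimately obtain C where C: "cp t C" "(C \<inter> R' \<noteq> {}) \<noteq> (C \<inter> B' \<noteq> {})"
      using cp_meets_one[OF tV, of R' B'] by (auto simp: R'_def B'_def)
    have Csub: "C \<subseteq> Y \<union> R' \<union> B'" using cp_sc[OF tV C(1)] cover by blast
    \<comment> \<open>A copy meeting \<open>R'\<close> would miss \<open>B'\<close>, hence lie in
      \<open>N \<union> R\<close> and contain a reaching node, which is excluded for
      \<open>t\<close> in \<open>Y\<close>.\<close>
    have "C \<inter> R' = {}"
    proof (rule ccontr)
      assume "C \<inter> R' \<noteq> {}"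
      moreover from this have "C \<subseteq> N \<union> R" using C(2) Csub by (auto simp: R'_def Y_def)
      moreover have "reach X (N \<union> R) x" if "x \<in> R'" for x
        using that Rr by (auto simp: R'_def Y_def)
      ultimately have "reach X (N \<union> R) t"
        using reach_step[OF X tV C(1)] by blast
      then show False using t by (simp add: Y_def)
    qed
    then have "C \<subseteq> Y \<union> B" "C \<inter> B \<noteq> {}" using C(2) Csub by (auto simp: B'_def)
    then show ?thesis using C(1) by blast
  qed simp
  have Zstep: "sc t \<subseteq> Z" if t: "t \<in> Z" for t
  proof -
    have tY: "t \<in> Y" and tV: "t \<in> V" using t by (auto simp: Z_def Y_def N_def)
    have no: "x \<notin> C" if "cp t C" "C \<subseteq> Y \<union> B" "reach (D - X) (Y \<union> B) x" for C x
      using reach_step[OF DX tV that(1,2) _ that(3)] t by (auto simp: Z_def)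
    \<comment> \<open>A successor outside \<open>Y\<close> would yield a copy meeting
      \<open>B\<close>, and \<open>t\<close> would reach. So \<open>sc t\<close> is itself a copy
      inside \<open>Y \<union> B\<close>, and none of its members reaches.\<close>
    then have "sc t \<subseteq> Y" using Ystep[OF tY] Br by blast
    then show ?thesis using no[OF cp_full[OF tV]] by (auto simp: Z_def)
  qed
  have ZV: "Z \<subseteq> V" and ZN: "Z \<inter> (R \<union> B) = {}" by (auto simp: Z_def Y_def N_def)
  have Zup: "nd b m \<in> Z" if "b \<in> D" "nd b n \<in> Z" "n \<le> m" for b n m
    using that(3)
  proof (induction rule: dec_induct)
    case (step k)
    then show ?case using nd_Suc[OF that(1)] Zstep by blast
  qed (rule that(2))
  have "Z = {}"
  proof (cases "\<forall>s\<in>Z. \<exists>b\<in>X. \<exists>n. nd b n = s")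
    case True
    have "sound X Z" unfolding sound_def reach_def
    proof
      fix s assume s: "s \<in> Z"
      then obtain b n where b: "b \<in> X" "nd b n = s" using True by blast
      then have bD: "b \<in> D" using X by blast
      have "cp (nd b m) (sc (nd b m)) \<and> nd b (Suc m) \<in> sc (nd b m) \<and> sc (nd b m) \<subseteq> Z"
        if "n \<le> m" for m
        using cp_full[OF nd_V[OF bD]] nd_Suc[OF bD] Zstep[OF Zup[OF bD _ that]] b s by simp
      then show "\<exists>b\<in>X. \<exists>n. nd b n = s \<and> (\<forall>m\<ge>n. \<exists>C. cp (nd b m) C \<and> nd b (Suc m) \<in> C \<and> C \<subseteq> Z)"
        using b by blast
    qed
    then show ?thesis using sound_imp_good ZN by (fastforce simp: R_def)
  next
    case False
    then obtain s where s: "s \<in> Z" "\<And>b n. b \<in> X \<Longrightarrow> nd b n \<noteq> s" by blast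
    \<comment> \<open>The cone above \<open>s\<close>. Every branch in \<open>D\<close> through
      \<open>s\<close> lies in \<open>D - X\<close>, so entire successor sets can serve as the
      copies.\<close>
    define W where "W = {nd c m |c m n. c \<in> D \<and> nd c n = s \<and> n \<le> m}"
    have "sound (D - X) W" unfolding sound_def reach_def
    proof
      fix u assume "u \<in> W"
      then obtain c m n where c: "c \<in> D" "nd c n = s" "n \<le> m" "u = nd c m"
        unfolding W_def by blast
      have "c \<in> D - X" using s c by blast
      moreover have "cp (nd c k) (sc (nd c k)) \<and> nd c (Suc k) \<in> sc (nd c k) \<and> sc (nd c k) \<subseteq> W"
        if k: "m \<le> k" for k
      proof (intro conjI subsetI)
        fix x assume "x \<in> sc (nd c k)"
        then obtain d where d: "d \<in> D" "nd d k = nd c k" "nd d (Suc k) = x"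
          using nd_dense[OF c(1)] by blast
        then have "nd d n = s" using nd_agree[OF d(1) c(1) _ d(2), of n] c k by simp
        then show "x \<in> W" using d c k unfolding W_def
          by (intro CollectI exI[of _ d] exI[of _ "Suc k"] exI[of _ n]) auto
      qed (use cp_full[OF nd_V[OF c(1)]] nd_Suc[OF c(1)] in auto)
      ultimately show "\<exists>b\<in>D - X. \<exists>n. nd b n = u \<and> (\<forall>m\<ge>n. \<exists>C. cp (nd b m) C \<and> nd b (Suc m) \<in> C \<and> C \<subseteq> W)"
        using c(4) by blast
    qed
    moreover have "s \<in> W" using s(1) ZV unfolding W_def V_def by blast
    ultimately show ?thesis using sound_imp_good s(1) ZN by (fastforce simp: B_def)
  qed
  then have "sound (D - X) (Y \<union> B)" using Br by (auto simp: sound_def Z_def)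
  then have "Y \<subseteq> B" using sound_imp_good by (auto simp: B_def)
  then show False using Y by (auto simp: Y_def N_def)
qed

theorem full_subset_of_class:
  assumes X: "X \<subseteq> D"
  shows "\<exists>E. (E \<subseteq> X \<or> E \<subseteq> D - X) \<and> E \<noteq> {} \<and> (\<forall>b\<in>E. \<forall>n. cp (nd b n) (succs E b n))"
proof -
  obtain b0 where b0: "b0 \<in> D" using nonempty by blast
  then have "nd b0 0 \<in> good X \<union> good (D - X)" using V_subset_good[OF X] nd_V by blast
  then show ?thesis
    using sound_imp_full_subset[OF X sound_good b0] sound_imp_full_subset[OF _ sound_good b0, of "D - X"]
    by blast
qed

end

section \<open>Back-and-forth between full sets\<close>

text \<open>Isomorphisms of both copies onto \<open>K\<close> conjugate \<open>\<pi>\<close> to a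
  finite partial isomorphism \<open>q\<close> of \<open>K\<close>. Its extension to an automorphism,
  conjugated back, is \<open>h\<close>.\<close>

lemma ultrahomogeneous_extend_between_copies:
  assumes C: "copy L K C" and C': "copy L K' C'" and KK': "isomorphic L K K'"
    and hom: "ultrahomogeneous L K"
    and P: "finite P" "P \<subseteq> C" and \<pi>: "partial_iso L K K' P \<pi>" "\<pi> ` P \<subseteq> C'"
  obtains h where "partial_iso L K K' C h" "h ` C \<subseteq> C'" "\<And>p. p \<in> P \<Longrightarrow> h p = \<pi> p"
proof -
  have sub: "C \<subseteq> univ K" "C' \<subseteq> univ K'" using C C' by (simp_all add: copy_def)
  obtain \<phi> where \<phi>: "iso_map L (restrict_struct K C) K \<phi>"
    using C unfolding copy_def isomorphic_def by blast
  obtain \<psi> where \<psi>: "iso_map L (restrict_struct K' C') K \<psi>"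
    using C' isomorphic_trans[OF _ isomorphic_sym[OF KK']] unfolding copy_def isomorphic_def by blast
  have p\<phi>: "partial_iso L K K C \<phi>" and p\<psi>: "partial_iso L K' K C' \<psi>"
    using \<phi> \<psi> sub unfolding iso_map_def partial_iso_def by auto
  have inj: "inj_on \<phi> C" "inj_on \<psi> C'" and im: "\<phi> ` C = univ K" "\<psi> ` C' = univ K"
    using \<phi> \<psi> by (simp_all add: iso_map_def partial_iso_def)
  define q where "q = \<psi> \<circ> (\<pi> \<circ> inv_into P \<phi>)"
  have invP: "inv_into P \<phi> (\<phi> p) = p" if "p \<in> P" for p
    using that inj(1) P(2) by (meson inj_on_subset inv_into_f_f)
  have "partial_iso L K K (\<phi> ` P) q"
    unfolding q_def
  proof (rule partial_iso_comp[OF partial_iso_comp[OF partial_iso_inv \<pi>(1)] p\<psi>])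
    show "partial_iso L K K P \<phi>" using partial_iso_subset[OF p\<phi> P(2)] .
  qed (use invP \<pi>(2) in auto)
  then obtain g where g: "iso_map L K K g" "\<And>z. z \<in> \<phi> ` P \<Longrightarrow> g z = q z"
    using hom P(1) unfolding ultrahomogeneous_def by (metis finite_imageI)
  define h where "h = inv_into C' \<psi> \<circ> (g \<circ> \<phi>)"
  have gK: "partial_iso L K K (univ K) g" "g ` univ K = univ K" using g(1) by (auto simp: iso_map_def)
  have g\<phi>: "(g \<circ> \<phi>) ` C = univ K" using im(1) gK(2) by (metis image_comp)
  have "partial_iso L K K' C h"
    unfolding h_def
    by (rule partial_iso_comp[OF partial_iso_comp[OF p\<phi> gK(1)] partial_iso_inv[OF p\<psi>]])
      (use im g\<phi> in auto)
  moreover have "h ` C \<subseteq> C'"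
  proof -
    have "h ` C = inv_into C' \<psi> ` \<psi> ` C'" using g\<phi> im(2) unfolding h_def by (metis image_comp)
    then show ?thesis using inj(2) by simp
  qed
  moreover have "h p = \<pi> p" if "p \<in> P" for p
  proof -
    have "g (\<phi> p) = \<psi> (\<pi> p)" using g(2)[of "\<phi> p"] that invP by (simp add: q_def)
    then show ?thesis using \<pi>(2) that inj(2) by (auto simp: h_def)
  qed
  ultimately show thesis using that by blast
qed

text \<open>An isomorphism sends \<open>a\<close> to a point of \<open>K'\<close> that agrees with
  \<open>a'\<close> on diagonal atoms. This serves tuples of branches that occupy one successor
  only, about which \<open>similar\<close> is silent at that level.\<close>

lemma isomorphic_transitive_same_diagonal:
  assumes "isomorphic L K K'" "transitive_struct L K'" "countable (univ K')"
    and "a \<in> univ K" "a' \<in> univ K'" "L R = Some n"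
  shows "rel K R (replicate n a) \<longleftrightarrow> rel K' R (replicate n a')"
proof -
  obtain \<theta> where \<theta>: "iso_map L K K' \<theta>" using assms(1) by (auto simp: isomorphic_def)
  then have "rel K R (replicate n a) \<longleftrightarrow> rel K' R (map \<theta> (replicate n a))"
    using assms(4,6) by (intro partial_isoD[of L K K' "univ K"]) (auto simp: iso_map_def)
  moreover have "\<theta> a \<in> univ K'" using \<theta> assms(4) by (auto simp: iso_map_def)
  ultimately show ?thesis
    using transitive_struct_same_diagonal[OF assms(2,3) _ assms(5,6), of "\<theta> a"] by simp
qed

locale branch_family_structs = branch_family sc D nd
  for sc :: "'a \<Rightarrow> 'a set" and D :: "'b set" and nd :: "'b \<Rightarrow> nat \<Rightarrow> 'a" +
  fixes L :: "'r language" and M :: "'a \<Rightarrow> ('r, 'a) struct"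
  assumes univ_M: "b \<in> D \<Longrightarrow> univ (M (nd b n)) = sc (nd b n)"
    and countable_M: "b \<in> D \<Longrightarrow> countable (sc (nd b n))"
    and isomorphic_M: "a \<in> D \<Longrightarrow> b \<in> D \<Longrightarrow> isomorphic L (M (nd a n)) (M (nd b n))"
    and ultrahomogeneous_M: "b \<in> D \<Longrightarrow> ultrahomogeneous L (M (nd b n))"
    and transitive_M: "b \<in> D \<Longrightarrow> transitive_struct L (M (nd b n))"
begin

definition full :: "'b set \<Rightarrow> bool" where
  "full E \<longleftrightarrow> E \<subseteq> D \<and> E \<noteq> {} \<and> (\<forall>b\<in>E. \<forall>n. copy L (M (nd b n)) (succs E b n))"

lemma full_D: "full D"
  unfolding full_def
proof (intro conjI ballI allI)
  show "copy L (M (nd b n)) (succs D b n)" if "b \<in> D" for b n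
    using copy_refl[of L "M (nd b n)"] by (simp add: univ_M[OF that] succs_D[OF that])
qed (use nonempty in auto)

text \<open>\<open>n\<close> is the level of the meet of the branches, the one place where the
  product evaluates a relation. Tuples of equal branches and the empty tuple never split.\<close>

definition splits :: "(nat \<Rightarrow> 'b) \<Rightarrow> nat list \<Rightarrow> nat \<Rightarrow> bool" where
  "splits e is n \<longleftrightarrow> (\<forall>i\<in>set is. \<forall>j\<in>set is. nd (e i) n = nd (e j) n) \<and>
     (\<exists>i\<in>set is. \<exists>j\<in>set is. nd (e i) (Suc n) \<noteq> nd (e j) (Suc n))"

text \<open>\<open>k\<close> names the common node: if the tuple splits at \<open>n\<close>, every
  \<open>k\<close> in \<open>is\<close> gives the same value.\<close>

definition rel_at :: "(nat \<Rightarrow> 'b) \<Rightarrow> 'r \<Rightarrow> nat list \<Rightarrow> nat \<Rightarrow> nat \<Rightarrow> bool" where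
  "rel_at e R is k n \<longleftrightarrow> rel (M (nd (e k) n)) R (map (\<lambda>i. nd (e i) (Suc n)) is)"

text \<open>The quantifier-free type of a family of branches: levels of pairwise meets, and
  relations where tuples split. The levels must match exactly, not just in order, because the
  symbols \<open>S \<alpha>\<close> see them.\<close>

definition similar :: "nat set \<Rightarrow> (nat \<Rightarrow> 'b) \<Rightarrow> (nat \<Rightarrow> 'b) \<Rightarrow> bool" where
  "similar I e e' \<longleftrightarrow>
     (\<forall>i\<in>I. \<forall>j\<in>I. \<forall>n. nd (e i) n = nd (e j) n \<longleftrightarrow> nd (e' i) n = nd (e' j) n) \<and>
     (\<forall>R is n k. set is \<subseteq> I \<and> L R = Some (length is) \<and> splits e is n \<and> k \<in> set is \<longrightarrow>
        (rel_at e R is k n \<longleftrightarrow> rel_at e' R is k n))"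

lemma similar_nd:
  "similar I e e' \<Longrightarrow> i \<in> I \<Longrightarrow> j \<in> I \<Longrightarrow> nd (e i) n = nd (e j) n \<longleftrightarrow> nd (e' i) n = nd (e' j) n"
  by (simp add: similar_def)

lemma similar_rel:
  "similar I e e' \<Longrightarrow> set is \<subseteq> I \<Longrightarrow> L R = Some (length is) \<Longrightarrow> splits e is n \<Longrightarrow> k \<in> set is \<Longrightarrow>
    rel_at e R is k n \<longleftrightarrow> rel_at e' R is k n"
  by (simp add: similar_def)

lemma similar_splits:
  assumes "similar I e e'" "set is \<subseteq> I"
  shows "splits e is n \<longleftrightarrow> splits e' is n"
proof -
  have "nd (e i) m = nd (e j) m \<longleftrightarrow> nd (e' i) m = nd (e' j) m" if "i \<in> set is" "j \<in> set is" for i j m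
    using similar_nd[OF assms(1)] assms(2) that by blast
  then show ?thesis by (simp add: splits_def)
qed

lemma similar_sym:
  assumes s: "similar I e e'"
  shows "similar I e' e"
  unfolding similar_def
proof (intro conjI allI impI ballI; (elim conjE)?)
  show "nd (e' i) n = nd (e' j) n \<longleftrightarrow> nd (e i) n = nd (e j) n" if "i \<in> I" "j \<in> I" for i j n
    using similar_nd[OF s that] by simp
  fix R "is" n k
  assume "set is \<subseteq> I" "L R = Some (length is)" "splits e' is n" "k \<in> set is"
  then show "rel_at e' R is k n \<longleftrightarrow> rel_at e R is k n"
    using similar_rel[OF s] similar_splits[OF s] by blast
qed

lemma similar_refl: "similar I e e"
  by (simp add: similar_def)

lemma splits_reindex: "splits (e \<circ> \<rho>) is n \<longleftrightarrow> splits e (map \<rho> is) n"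
  by (simp add: splits_def)

lemma rel_at_reindex: "rel_at (e \<circ> \<rho>) R is k n \<longleftrightarrow> rel_at e R (map \<rho> is) (\<rho> k) n"
  by (simp add: rel_at_def comp_def)

text \<open>Meant for a non-injective \<open>\<rho>\<close>: a new index can borrow the branch of an
  old one.\<close>

lemma similar_reindex:
  assumes s: "similar I e e'" and \<rho>: "\<rho> ` J \<subseteq> I"
  shows "similar J (e \<circ> \<rho>) (e' \<circ> \<rho>)"
  unfolding similar_def splits_reindex rel_at_reindex
proof (intro conjI allI impI ballI; (elim conjE)?)
  show "nd ((e \<circ> \<rho>) i) n = nd ((e \<circ> \<rho>) j) n \<longleftrightarrow> nd ((e' \<circ> \<rho>) i) n = nd ((e' \<circ> \<rho>) j) n"
    if "i \<in> J" "j \<in> J" for i j n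
    using similar_nd[OF s, of "\<rho> i" "\<rho> j"] that \<rho> by auto
  fix R "is" n k
  assume "set is \<subseteq> J" "L R = Some (length is)" "splits e (map \<rho> is) n" "k \<in> set is"
  moreover from this have "set (map \<rho> is) \<subseteq> I" using \<rho> by auto
  ultimately show "rel_at e R (map \<rho> is) (\<rho> k) n \<longleftrightarrow> rel_at e' R (map \<rho> is) (\<rho> k) n"
    by (intro similar_rel[OF s]) auto
qed

lemma similar_mono: "similar I e e' \<Longrightarrow> J \<subseteq> I \<Longrightarrow> similar J e e'"
  using similar_reindex[of I e e' "\<lambda>i. i" J] by (simp add: comp_def)

lemma splits_cong:
  assumes "\<And>i. i \<in> set is \<Longrightarrow> nd (e i) n = nd (f i) n"
    "\<And>i. i \<in> set is \<Longrightarrow> nd (e i) (Suc n) = nd (f i) (Suc n)"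
  shows "splits e is n \<longleftrightarrow> splits f is n"
  using assms by (simp add: splits_def)

lemma rel_at_cong:
  assumes "\<And>i. i \<in> set is \<Longrightarrow> nd (e i) n = nd (f i) n" "k \<in> set is"
    "\<And>i. i \<in> set is \<Longrightarrow> nd (e i) (Suc n) = nd (f i) (Suc n)"
  shows "rel_at e R is k n \<longleftrightarrow> rel_at f R is k n"
proof -
  have "map (\<lambda>i. nd (e i) (Suc n)) is = map (\<lambda>i. nd (f i) (Suc n)) is" using assms(3) by simp
  then show ?thesis unfolding rel_at_def assms(1)[OF assms(2)] by (rule arg_cong)
qed

lemma similar_cong:
  assumes s: "similar I e e'" and "\<And>i. i \<in> I \<Longrightarrow> f i = e i" "\<And>i. i \<in> I \<Longrightarrow> f' i = e' i"
  shows "similar I f f'"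
  unfolding similar_def
proof (intro conjI allI impI ballI; (elim conjE)?)
  show "nd (f i) n = nd (f j) n \<longleftrightarrow> nd (f' i) n = nd (f' j) n" if "i \<in> I" "j \<in> I" for i j n
    using similar_nd[OF s that] assms that by simp
  fix R "is" n k
  assume *: "set is \<subseteq> I" "L R = Some (length is)" "splits f is n" "k \<in> set is"
  have eq: "f i = e i" "f' i = e' i" if "i \<in> set is" for i using assms *(1) that by auto
  have "splits e is n" using *(3) splits_cong[of "is" f n e] eq by simp
  then have "rel_at e R is k n \<longleftrightarrow> rel_at e' R is k n" using similar_rel[OF s *(1,2) _ *(4)] by blast
  moreover have "rel_at f R is k n \<longleftrightarrow> rel_at e R is k n" using *(4) eq by (intro rel_at_cong) auto
  moreover have "rel_at f' R is k n \<longleftrightarrow> rel_at e' R is k n" using *(4) eq by (intro rel_at_cong) auto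
  ultimately show "rel_at f R is k n \<longleftrightarrow> rel_at f' R is k n" by simp
qed

text \<open>The new branch \<open>x\<close> leaves the old ones at level \<open>n\<close>, at a node of \<open>e j0\<close>. Among the
  successors of that node, the finite partial isomorphism induced by \<open>e\<close> and \<open>e'\<close> is extended
  to the successor on \<open>x\<close>. If only one successor is occupied, that map is a partial isomorphism
  by transitivity.\<close>

lemma similar_extend:
  assumes E: "full E" and F: "full F" and I: "finite I" "i \<notin> I" and s: "similar I e e'"
    and eE: "e ` I \<subseteq> E" and eF: "e' ` I \<subseteq> F" and x: "x \<in> E"
  shows "\<exists>y\<in>F. similar (insert i I) (e(i := x)) (e'(i := y))"
proof -
  have ED: "E \<subseteq> D" and FD: "F \<subseteq> D" and xD: "x \<in> D" using E F x by (auto simp: full_def)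
  have eD: "e j \<in> D" "e' j \<in> D" if "j \<in> I" for j using that eE eF ED FD by auto
  consider "I = {}" | j where "j \<in> I" "x = e j" | "I \<noteq> {}" "x \<notin> e ` I" by blast
  then show ?thesis
  proof cases
    case 1
    obtain y where "y \<in> F" using F by (auto simp: full_def)
    moreover have "\<not> splits (e(i := x)) is n" if "set is \<subseteq> {i}" for "is" n
      using that by (auto simp: splits_def subset_iff)
    ultimately show ?thesis using 1 by (auto simp: similar_def)
  next
    case 2
    define \<rho> where "\<rho> k = (if k = i then j else k)" for k
    have "similar (insert i I) (e \<circ> \<rho>) (e' \<circ> \<rho>)"
      using 2(1) by (intro similar_reindex[OF s]) (auto simp: \<rho>_def)
    then have "similar (insert i I) (e(i := x)) (e'(i := e' j))"
      by (rule similar_cong) (use I(2) 2 in \<open>auto simp: \<rho>_def\<close>)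
    then show ?thesis using eF 2(1) by blast
  next
    case 3
    \<comment> \<open>The levels where \<open>x\<close> still runs along an old branch: finitely
      many, as \<open>x\<close> is new and \<open>I\<close> is finite, and including the root. Their
      maximum is where \<open>x\<close> leaves.\<close>
    define S where "S = {n. \<exists>j\<in>I. nd x n = nd (e j) n}"
    have "finite S"
    proof -
      have "finite {n. nd x n = nd (e j) n}" if j: "j \<in> I" for j
      proof -
        have "x \<noteq> e j" using 3(2) j by auto
        then obtain m where m: "nd x m \<noteq> nd (e j) m" using nd_eqI[OF xD eD(1)[OF j]] by blast
        have "{n. nd x n = nd (e j) n} \<subseteq> {..m}"
        proof
          fix n assume "n \<in> {n. nd x n = nd (e j) n}"
          then show "n \<in> {..m}" using nd_agree[OF xD eD(1)[OF j], of m n] m by (cases "m \<le> n") auto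
        qed
        then show ?thesis by (rule finite_subset) simp
      qed
      moreover have "S = (\<Union>j\<in>I. {n. nd x n = nd (e j) n})" by (auto simp: S_def)
      ultimately show ?thesis using I(1) by simp
    qed
    moreover have "0 \<in> S" using 3(1) nd_0[OF xD eD(1)] unfolding S_def by blast
    ultimately have MaxS: "Max S \<in> S" "\<And>k. k \<in> S \<Longrightarrow> k \<le> Max S" by (auto intro: Max_in)
    define n where "n = Max S"
    obtain j0 where j0: "j0 \<in> I" "nd x n = nd (e j0) n" using MaxS(1) by (auto simp: S_def n_def)
    have low: "nd x k = nd (e j0) k" if "k \<le> n" for k
      using nd_agree[OF xD eD(1)[OF j0(1)] that j0(2)] .
    have high: "nd x k \<noteq> nd (e j) k" if "n < k" "j \<in> I" for k j
      using MaxS(2)[of k] that by (auto simp: S_def n_def)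
    define U where "U = {j \<in> I. nd (e j) n = nd x n}"
    define P where "P = (\<lambda>j. nd (e j) (Suc n)) ` U"
    \<comment> \<open>Several old branches may pass through \<open>p\<close>; by similarity at level
      \<open>Suc n\<close> their partners share a node, so any choice gives the same value.\<close>
    define \<pi> where "\<pi> p = nd (e' (SOME j. j \<in> U \<and> nd (e j) (Suc n) = p)) (Suc n)" for p
    have U': "nd (e' j) n = nd (e' j0) n" if "j \<in> U" for j
      using that similar_nd[OF s _ j0(1), of j n] j0(2) by (simp add: U_def)
    have \<pi>: "\<pi> (nd (e j) (Suc n)) = nd (e' j) (Suc n)" if j: "j \<in> U" for j
    proof -
      define j' where "j' = (SOME j'. j' \<in> U \<and> nd (e j') (Suc n) = nd (e j) (Suc n))"
      have "j' \<in> U \<and> nd (e j') (Suc n) = nd (e j) (Suc n)"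
        unfolding j'_def by (rule someI[of _ j]) (use j in simp)
      then show ?thesis
        using similar_nd[OF s, of j' j "Suc n"] j by (auto simp: \<pi>_def j'_def U_def)
    qed
    define K K' C C' where "K = M (nd x n)" and "K' = M (nd (e' j0) n)"
      and "C = succs E x n" and "C' = succs F (e' j0) n"
    have j0D: "e' j0 \<in> D" and j0F: "e' j0 \<in> F" using eD eF j0(1) by auto
    have C: "copy L K C" and C': "copy L K' C'"
      using E F x j0F by (auto simp: full_def K_def K'_def C_def C'_def)
    have KK': "isomorphic L K K'" unfolding K_def K'_def by (rule isomorphic_M[OF xD j0D])
    have CK: "C \<subseteq> univ K" "C' \<subseteq> univ K'" using C C' by (auto simp: copy_def)
    have PC: "P \<subseteq> C"
      using eE by (auto simp: P_def U_def C_def succs_def)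
    have \<pi>C: "\<pi> ` P \<subseteq> C'"
    proof -
      have "nd (e' j) (Suc n) \<in> C'" if "j \<in> U" for j
        using U'[OF that] that eF unfolding C'_def succs_def U_def by blast
      then show ?thesis using \<pi> by (auto simp: P_def)
    qed
    have "finite P" using I(1) by (simp add: P_def U_def)
    have pi: "partial_iso L K K' P \<pi>"
      unfolding partial_iso_def
    proof (intro conjI allI impI)
      show "P \<subseteq> univ K" "\<pi> ` P \<subseteq> univ K'" using PC \<pi>C CK by auto
      show "inj_on \<pi> P"
      proof (rule inj_onI)
        fix p q assume "p \<in> P" "q \<in> P" "\<pi> p = \<pi> q"
        then obtain j k where "j \<in> U" "k \<in> U" "p = nd (e j) (Suc n)" "q = nd (e k) (Suc n)"
          "nd (e' j) (Suc n) = nd (e' k) (Suc n)"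
          using \<pi> by (auto simp: P_def)
        then show "p = q" using similar_nd[OF s, of j k "Suc n"] by (auto simp: U_def)
      qed
      fix R xs assume xs: "set xs \<subseteq> P \<and> L R = Some (length xs)"
      then have "xs \<in> lists ((\<lambda>j. nd (e j) (Suc n)) ` U)" by (auto simp: P_def)
      then obtain "is" where "is": "set is \<subseteq> U" "xs = map (\<lambda>j. nd (e j) (Suc n)) is"
        unfolding lists_image by (auto simp: in_lists_conv_set)
      have map: "map \<pi> xs = map (\<lambda>j. nd (e' j) (Suc n)) is"
        using \<pi> "is" by auto
      show "rel K R xs \<longleftrightarrow> rel K' R (map \<pi> xs)"
      proof (cases "splits e is n")
        case True
        then obtain k where k: "k \<in> set is" by (auto simp: splits_def)
        then have "rel_at e R is k n \<longleftrightarrow> rel_at e' R is k n"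
          using similar_rel[OF s, of "is" R n k] True "is" xs by (auto simp: U_def)
        moreover have "nd (e k) n = nd x n" using k "is" by (auto simp: U_def)
        moreover have "nd (e' k) n = nd (e' j0) n" using k "is" U' by auto
        ultimately show ?thesis
          unfolding map using "is"(2) by (simp add: rel_at_def K_def K'_def)
      next
        case False
        obtain a where a: "a \<in> P" "xs = replicate (length xs) a"
        proof -
          have j0U: "j0 \<in> U" using j0 by (simp add: U_def)
          have same: "nd (e j) (Suc n) = nd (e k) (Suc n)" if "j \<in> set is" "k \<in> set is" for j k
          proof -
            have "nd (e j) n = nd x n" if "j \<in> set is" for j using "is"(1) that by (auto simp: U_def)
            then have "\<forall>i\<in>set is. \<forall>j\<in>set is. nd (e i) n = nd (e j) n" by simp
            then show ?thesis using False that unfolding splits_def by blast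
          qed
          \<comment> \<open>A nullary symbol gives the empty tuple; \<open>j0\<close> then supplies
            the required point of \<open>P\<close>.\<close>
          define k where "k = (if is = [] then j0 else hd is)"
          have "k \<in> U" using j0U "is"(1) by (auto simp: k_def)
          moreover have "xs = replicate (length xs) (nd (e k) (Suc n))"
          proof (rule replicate_eqI)
            fix z assume "z \<in> set xs"
            then obtain j where j: "j \<in> set is" "z = nd (e j) (Suc n)" using "is"(2) by auto
            then have "k \<in> set is" by (auto simp: k_def)
            then show "z = nd (e k) (Suc n)" unfolding j(2) by (rule same[OF j(1)])
          qed simp
          ultimately show ?thesis using that[of "nd (e k) (Suc n)"] by (auto simp: P_def)
        qed
        have "map \<pi> xs = replicate (length xs) (\<pi> a)" by (subst a(2)) simp
        moreover have "a \<in> univ K" "\<pi> a \<in> univ K'" using a(1) PC \<pi>C CK by auto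
        moreover have "transitive_struct L K'" "countable (univ K')"
          using transitive_M[OF j0D] countable_M[OF j0D] univ_M[OF j0D] by (simp_all add: K'_def)
        ultimately show ?thesis
          using isomorphic_transitive_same_diagonal[OF KK', of a "\<pi> a" R "length xs"] xs a(2) by simp
      qed
    qed
    obtain h where h: "partial_iso L K K' C h" "h ` C \<subseteq> C'" "\<And>p. p \<in> P \<Longrightarrow> h p = \<pi> p"
      using ultrahomogeneous_extend_between_copies[OF C C' KK' _ \<open>finite P\<close> PC pi \<pi>C]
        ultrahomogeneous_M[OF xD] unfolding K_def by blast
    have xC: "nd x (Suc n) \<in> C" using x by (auto simp: C_def succs_def)
    then have "h (nd x (Suc n)) \<in> C'" using h(2) by blast
    then obtain y where y: "y \<in> F" "nd y n = nd (e' j0) n" "nd y (Suc n) = h (nd x (Suc n))"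
      unfolding C'_def succs_def by auto
    have yD: "y \<in> D" using y(1) FD by blast
    have low': "nd y k = nd (e' j0) k" if "k \<le> n" for k
      using nd_agree[OF yD j0D that y(2)] .
    \<comment> \<open>By injectivity of \<open>h\<close> on \<open>C\<close>: if \<open>y\<close>
      followed \<open>e' j\<close> past level \<open>n\<close>, then \<open>x\<close> would follow
      \<open>e j\<close> to level \<open>Suc n\<close>.\<close>
    have high': "nd y k \<noteq> nd (e' j) k" if k: "n < k" and j: "j \<in> I" for k j
    proof
      assume eq: "nd y k = nd (e' j) k"
      then have eqS: "nd y (Suc n) = nd (e' j) (Suc n)" and "nd y n = nd (e' j) n"
        using nd_agree[OF yD eD(2)[OF j] _ eq] k by auto
      then have "nd (e' j) n = nd (e' j0) n" using y(2) by simp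
      then have jU: "j \<in> U" using similar_nd[OF s j j0(1)] j j0(2) by (auto simp: U_def)
      then have pP: "nd (e j) (Suc n) \<in> P" by (auto simp: P_def)
      then have "h (nd x (Suc n)) = h (nd (e j) (Suc n))"
        using eqS y(3) \<pi>[OF jU] h(3) by simp
      then have "nd x (Suc n) = nd (e j) (Suc n)"
        using h(1) xC pP PC unfolding partial_iso_def by (meson inj_onD subsetD)
      then show False using high[of "Suc n" j] j by simp
    qed
    have agr: "nd x k = nd (e j) k \<longleftrightarrow> nd y k = nd (e' j) k" if j: "j \<in> I" for j k
      using low[of k] low'[of k] high[of k j] high'[of k j] similar_nd[OF s j0(1) j, of k] j
      by (cases "k \<le> n") auto
    let ?e = "e(i := x)" and ?e' = "e'(i := y)"
    have "similar (insert i I) ?e ?e'"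
      unfolding similar_def
    proof (intro conjI allI impI ballI; (elim conjE)?)
      fix a b k assume "a \<in> insert i I" "b \<in> insert i I"
      then show "nd (?e a) k = nd (?e b) k \<longleftrightarrow> nd (?e' a) k = nd (?e' b) k"
        using agr[of b k] agr[of a k] similar_nd[OF s, of a b k]
          eq_commute[of "nd (e a) k" "nd x k"] eq_commute[of "nd (e' a) k" "nd y k"]
        by (cases "a = i"; cases "b = i") simp_all
    next
      fix R "is" l k
      assume "is": "set is \<subseteq> insert i I" and R: "L R = Some (length is)"
        and sp: "splits ?e is l" and k: "k \<in> set is"
      show "rel_at ?e R is k l \<longleftrightarrow> rel_at ?e' R is k l"
      proof (cases "i \<in> set is")
        case False
        then have sub: "set is \<subseteq> I" using "is" by auto
        have "similar I ?e ?e'" by (rule similar_cong[OF s]) (use I(2) in auto)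
        then show ?thesis using similar_rel[OF _ sub R sp k] by blast
      next
        case True
        have "\<exists>j\<in>set is. j \<noteq> i"
        proof (rule ccontr)
          assume "\<not> ?thesis"
          then have "a = i" if "a \<in> set is" for a using that by blast
          then show False using sp unfolding splits_def by metis
        qed
        then obtain j where j: "j \<in> set is" "j \<noteq> i" by blast
        then have jI: "j \<in> I" using "is" by auto
        have "nd (?e i) l = nd (?e j) l" using sp True j(1) unfolding splits_def by blast
        then have "nd x l = nd (e j) l" using j(2) by simp
        then have "l \<le> n" using high[OF _ jI, of l] by (meson not_le)
        then consider "l < n" | "l = n" by linarith
        then show ?thesis
        proof cases
          case 1
          \<comment> \<open>Both \<open>l\<close> and \<open>Suc l\<close> are at most
            \<open>n\<close>, where \<open>x\<close> and \<open>y\<close> still run along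
            \<open>e j0\<close> and \<open>e' j0\<close>; so \<open>i\<close> can be replaced by
            \<open>j0\<close>.\<close>
          define \<rho> where "\<rho> a = (if a = i then j0 else a)" for a
          have nd\<rho>: "nd (?e a) m = nd ((e \<circ> \<rho>) a) m" "nd (?e' a) m = nd ((e' \<circ> \<rho>) a) m"
            if "m \<le> n" for a m
            using low[OF that] low'[OF that] by (auto simp: \<rho>_def)
          have ln: "l \<le> n" "Suc l \<le> n" using 1 by auto
          have "similar (set is) (e \<circ> \<rho>) (e' \<circ> \<rho>)"
            using "is" j0(1) by (intro similar_reindex[OF s]) (auto simp: \<rho>_def)
          moreover have "splits (e \<circ> \<rho>) is l"
            using sp splits_cong[of "is" ?e l "e \<circ> \<rho>"] nd\<rho>(1) ln by blast
          ultimately have "rel_at (e \<circ> \<rho>) R is k l \<longleftrightarrow> rel_at (e' \<circ> \<rho>) R is k l"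
            using similar_rel R k by blast
          moreover have "rel_at ?e R is k l \<longleftrightarrow> rel_at (e \<circ> \<rho>) R is k l"
            by (rule rel_at_cong[OF nd\<rho>(1)[OF ln(1)] k nd\<rho>(1)[OF ln(2)]])
          moreover have "rel_at ?e' R is k l \<longleftrightarrow> rel_at (e' \<circ> \<rho>) R is k l"
            by (rule rel_at_cong[OF nd\<rho>(2)[OF ln(1)] k nd\<rho>(2)[OF ln(2)]])
          ultimately show ?thesis by blast
        next
          case 2
          \<comment> \<open>At level \<open>n\<close> the whole tuple passes through the node of
            \<open>x\<close>, so its successors lie in \<open>C\<close>, where \<open>h\<close>
            preserves relations.\<close>
          have U: "a \<in> U" if "a \<in> set is" "a \<noteq> i" for a
          proof -
            have "nd (?e a) n = nd (?e i) n" using sp True that(1) 2 unfolding splits_def by blast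
            then show ?thesis using that "is" by (auto simp: U_def)
          qed
          define xs where "xs = map (\<lambda>a. nd (?e a) (Suc n)) is"
          have "nd (?e a) (Suc n) \<in> C \<and> h (nd (?e a) (Suc n)) = nd (?e' a) (Suc n)"
            if a: "a \<in> set is" for a
          proof (cases "a = i")
            case False
            then have "a \<in> U" using U a by blast
            moreover from this have "nd (e a) (Suc n) \<in> P" by (simp add: P_def)
            ultimately show ?thesis using PC h(3) \<pi> False by auto
          qed (use xC y(3) in simp)
          then have xs: "set xs \<subseteq> C" "map h xs = map (\<lambda>a. nd (?e' a) (Suc n)) is"
            by (auto simp: xs_def)
          have "rel K R xs \<longleftrightarrow> rel K' R (map h xs)"
            by (rule partial_isoD[OF h(1) xs(1)]) (simp add: R xs_def)
          moreover have "nd (?e k) n = nd x n"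
            using U[OF k] by (auto simp: U_def)
          moreover have "nd (?e' k) n = nd (e' j0) n"
            using U[OF k] U'[of k] y(2) by auto
          ultimately show ?thesis unfolding rel_at_def 2 xs(2) by (simp add: K_def K'_def xs_def)
        qed
      qed
    qed
    then show ?thesis using y(1) by blast
  qed
qed

end

section \<open>Structures whose atoms are decided by similarity\<close>

locale branch_structure = branch_family_structs sc D nd L M
  for sc :: "'a \<Rightarrow> 'a set" and D :: "'b set" and nd :: "'b \<Rightarrow> nat \<Rightarrow> 'a"
    and L :: "'r language" and M :: "'a \<Rightarrow> ('r, 'a) struct" +
  fixes L' :: "'q language" and \<A> :: "('q, 'b) struct"
  assumes similar_atoms: "similar I e e' \<Longrightarrow> e ` I \<subseteq> D \<Longrightarrow> e' ` I \<subseteq> D \<Longrightarrow> set is \<subseteq> I \<Longrightarrow>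
    L' Q = Some (length is) \<Longrightarrow> rel \<A> Q (map e is) \<longleftrightarrow> rel \<A> Q (map e' is)"
begin

lemma similar_eq:
  assumes s: "similar I e e'" and D: "e ` I \<subseteq> D" "e' ` I \<subseteq> D" and ij: "i \<in> I" "j \<in> I"
  shows "e i = e j \<longleftrightarrow> e' i = e' j"
proof -
  have mem: "e i \<in> D" "e j \<in> D" "e' i \<in> D" "e' j \<in> D" using D ij by auto
  have "e i = e j \<longleftrightarrow> (\<forall>n. nd (e i) n = nd (e j) n)" using nd_eqI[OF mem(1,2)] by metis
  also have "\<dots> \<longleftrightarrow> (\<forall>n. nd (e' i) n = nd (e' j) n)" using similar_nd[OF s ij] by simp
  also have "\<dots> \<longleftrightarrow> e' i = e' j" using nd_eqI[OF mem(3,4)] by metis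
  finally show ?thesis .
qed

lemma finite_fv: "finite (fv \<phi>)"
  by (induction \<phi>) auto

text \<open>The quantifier step is \<open>similar_extend\<close> in both directions; it works over
  finite families, hence similarity on \<open>fv \<phi>\<close> only. With \<open>F = D\<close> and
  \<open>e' = e\<close> this is elementarity of a full subset.\<close>

lemma similar_sat:
  assumes E: "full E" and F: "full F"
    and "wf_fm L' \<phi>" "range e \<subseteq> E" "range e' \<subseteq> F" "similar (fv \<phi>) e e'"
  shows "sat (restrict_struct \<A> E) e \<phi> \<longleftrightarrow> sat (restrict_struct \<A> F) e' \<phi>"
  using assms(3-)
proof (induction \<phi> arbitrary: e e')
  case (Eq i j)
  then show ?case
    using similar_eq[OF Eq(4), of i j] E F by (auto simp: full_def)
next
  case (Rel R xs)
  then have "e ` fv (Rel R xs) \<subseteq> D" "e' ` fv (Rel R xs) \<subseteq> D" using E F by (auto simp: full_def)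
  then show ?case using similar_atoms[OF Rel(4), of xs R] Rel(1) by simp
next
  case (Conj \<phi> \<psi>)
  have "similar (fv \<phi>) e e'" "similar (fv \<psi>) e e'" using Conj.prems(4) by (auto elim: similar_mono)
  then show ?case using Conj by simp
next
  case (Exi i \<phi>)
  define I where "I = fv \<phi> - {i}"
  have I: "finite I" "i \<notin> I" "fv \<phi> \<subseteq> insert i I" by (auto simp: I_def finite_fv)
  have s: "similar I e e'" using Exi.prems by (simp add: I_def)
  have sub: "e ` I \<subseteq> E" "e' ` I \<subseteq> F" using Exi.prems by auto
  have IH: "sat (restrict_struct \<A> E) (e(i := x)) \<phi> \<longleftrightarrow> sat (restrict_struct \<A> F) (e'(i := y)) \<phi>"
    if "x \<in> E" "y \<in> F" "similar (insert i I) (e(i := x)) (e'(i := y))" for x y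
  proof (rule Exi.IH[OF _ _ _ similar_mono[OF that(3) I(3)]])
    show "range (e(i := x)) \<subseteq> E" "range (e'(i := y)) \<subseteq> F" using Exi.prems that by auto
  qed (use Exi.prems in simp)
  show ?case
  proof
    assume "sat (restrict_struct \<A> E) e (Exi i \<phi>)"
    then obtain x where x: "x \<in> E" "sat (restrict_struct \<A> E) (e(i := x)) \<phi>" by auto
    then obtain y where "y \<in> F" "similar (insert i I) (e(i := x)) (e'(i := y))"
      using similar_extend[OF E F I(1,2) s sub] by blast
    then show "sat (restrict_struct \<A> F) e' (Exi i \<phi>)" using IH x by auto
  next
    assume "sat (restrict_struct \<A> F) e' (Exi i \<phi>)"
    then obtain y where y: "y \<in> F" "sat (restrict_struct \<A> F) (e'(i := y)) \<phi>" by auto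
    then obtain x where "x \<in> E" "similar (insert i I) (e'(i := y)) (e(i := x))"
      using similar_extend[OF F E I(1,2) similar_sym[OF s] sub(2,1)] by blast
    then show "sat (restrict_struct \<A> E) e (Exi i \<phi>)" using IH[OF _ y(1) similar_sym] y(2) by auto
  qed
qed simp_all

text \<open>Stage \<open>n\<close> of the back-and-forth settles entry \<open>n\<close> of both
  sequences: at even stages a prescribed member of \<open>E\<close> receives a partner in
  \<open>F\<close>, at odd stages the reverse. Entries may repeat.\<close>

lemma similar_enumerations:
  assumes E: "full E" "countable E" and F: "full F" "countable F"
  obtains e e' where "range e = E" "range e' = F" "similar UNIV e e'"
proof -
  have ne: "E \<noteq> {}" "F \<noteq> {}" using E F by (auto simp: full_def)
  define p q where "p = from_nat_into E" and "q = from_nat_into F"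
  have pq: "range p = E" "range q = F"
    using range_from_nat_into ne E(2) F(2) by (auto simp: p_def q_def)
  define P where "P n s \<longleftrightarrow> range (fst s) \<subseteq> E \<and> range (snd s) \<subseteq> F \<and> similar {..<n} (fst s) (snd s)"
    for n :: nat and s
  define Q where "Q n s s' \<longleftrightarrow> (\<exists>x y. s' = ((fst s)(n := x), (snd s)(n := y)) \<and>
      (if even n then x = p (n div 2) else y = q (n div 2)))"
    for n :: nat and s s' :: "(nat \<Rightarrow> 'b) \<times> (nat \<Rightarrow> 'b)"
  have "\<exists>f. \<forall>n. P n (f n) \<and> Q n (f n) (f (Suc n))"
  proof (rule dependent_nat_choice)
    have "P 0 (p, q)" using pq by (simp add: P_def similar_def splits_def)
    then show "\<exists>s. P 0 s" ..
    fix s n assume Ps: "P n s"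
    obtain e e' where s: "s = (e, e')" by (cases s)
    have *: "range e \<subseteq> E" "range e' \<subseteq> F" "similar {..<n} e e'" using Ps by (auto simp: P_def s)
    then have sub: "e ` {..<n} \<subseteq> E" "e' ` {..<n} \<subseteq> F" by auto
    have n: "finite {..<n}" "n \<notin> {..<n}" "insert n {..<n} = {..<Suc n}" by auto
    obtain x y where xy: "x \<in> E" "y \<in> F" "similar {..<Suc n} (e(n := x)) (e'(n := y))"
      "if even n then x = p (n div 2) else y = q (n div 2)"
    proof (cases "even n")
      case True
      then show ?thesis
        using similar_extend[OF E(1) F(1) n(1,2) *(3) sub, of "p (n div 2)"] pq that
        unfolding n(3) by auto
    next
      case False
      then show ?thesis
        using similar_extend[OF F(1) E(1) n(1,2) similar_sym[OF *(3)] sub(2,1), of "q (n div 2)"] pq that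
        unfolding n(3) by (metis rangeI similar_sym)
    qed
    then have "P (Suc n) (e(n := x), e'(n := y)) \<and> Q n s (e(n := x), e'(n := y))"
      using * unfolding P_def Q_def s fst_conv snd_conv by (intro conjI exI[of _ x] exI[of _ y] refl) auto
    then show "\<exists>s'. P (Suc n) s' \<and> Q n s s'" ..
  qed
  then obtain f where f: "\<And>n. P n (f n)" "\<And>n. Q n (f n) (f (Suc n))" by blast
  \<comment> \<open>Entry \<open>k\<close> is set in passing from stage \<open>k\<close> to stage
    \<open>Suc k\<close> and never changed again.\<close>
  define e e' where "e k = fst (f (Suc k)) k" and "e' k = snd (f (Suc k)) k" for k
  have stable: "fst (f n) k = e k \<and> snd (f n) k = e' k" if "Suc k \<le> n" for k n
    using that
  proof (induction rule: dec_induct)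
    case (step n)
    then show ?case using f(2)[of n] by (auto simp: Q_def)
  qed (simp add: e_def e'_def)
  have fin: "similar {..<n} e e'" for n
  proof (rule similar_cong)
    show "similar {..<n} (fst (f n)) (snd (f n))" using f(1)[of n] by (simp add: P_def)
  qed (use stable in auto)
  \<comment> \<open>Each clause of \<open>similar\<close> mentions finitely many indices, so it
    holds at some finite stage.\<close>
  have "similar UNIV e e'"
    unfolding similar_def
  proof (intro conjI allI impI ballI; (elim conjE)?)
    fix i j n
    show "nd (e i) n = nd (e j) n \<longleftrightarrow> nd (e' i) n = nd (e' j) n"
      using similar_nd[OF fin[of "Suc (max i j)"], of i j n] by simp
  next
    fix R "is" n k assume *: "L R = Some (length is)" "splits e is n" "k \<in> set is"
    obtain m where "set is \<subseteq> {..<m}" using finite_nat_iff_bounded by blast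
    then show "rel_at e R is k n \<longleftrightarrow> rel_at e' R is k n" using similar_rel[OF fin _ *] by blast
  qed
  moreover have "range e \<subseteq> E" "range e' \<subseteq> F"
    using f(1) by (auto simp: P_def e_def e'_def)
  moreover have "E \<subseteq> range e"
  proof -
    have "e (2 * k) = p k" for k using f(2)[of "2 * k"] by (auto simp: Q_def e_def)
    then show ?thesis using pq(1) by (metis image_subset_iff rangeI subsetI)
  qed
  moreover have "F \<subseteq> range e'"
  proof -
    have "e' (Suc (2 * k)) = q k" for k using f(2)[of "Suc (2 * k)"] by (auto simp: Q_def e'_def)
    then show ?thesis using pq(2) by (metis image_subset_iff rangeI subsetI)
  qed
  ultimately show thesis using that by blast
qed

lemma full_isomorphic:
  assumes E: "full E" "countable E" and F: "full F" "countable F"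
  shows "isomorphic L' (restrict_struct \<A> E) (restrict_struct \<A> F)"
proof -
  obtain e e' where e: "range e = E" "range e' = F" "similar UNIV e e'"
    using similar_enumerations[OF E F] .
  have D: "range e \<subseteq> D" "range e' \<subseteq> D" using e E F by (auto simp: full_def)
  have eq: "e i = e j \<longleftrightarrow> e' i = e' j" for i j using similar_eq[OF e(3) D] by simp
  \<comment> \<open>\<open>inv e\<close> picks one of possibly many indices of \<open>x\<close>; by
    \<open>eq\<close> all of them give the same value.\<close>
  define g where "g x = e' (inv e x)" for x
  have g: "g (e i) = e' i" for i
    using eq[of "inv e (e i)" i] by (simp add: g_def f_inv_into_f)
  have "iso_map L' (restrict_struct \<A> E) (restrict_struct \<A> F) g"
    unfolding iso_map_def partial_iso_def
  proof (intro conjI allI impI)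
    show gE: "g ` univ (restrict_struct \<A> E) = univ (restrict_struct \<A> F)"
      using g unfolding restrict_struct_simps e(1)[symmetric] e(2)[symmetric] by (simp add: image_image)
    then show "g ` univ (restrict_struct \<A> E) \<subseteq> univ (restrict_struct \<A> F)" by simp
    show "inj_on g (univ (restrict_struct \<A> E))"
      using g eq unfolding restrict_struct_simps e(1)[symmetric] by (auto simp: inj_on_def)
    fix R xs assume xs: "set xs \<subseteq> univ (restrict_struct \<A> E) \<and> L' R = Some (length xs)"
    then have "map e (map (inv e) xs) = xs"
      using e(1) by (auto simp: f_inv_into_f subset_iff intro!: map_idI)
    then obtain "is" where "is": "xs = map e is" by metis
    moreover have "map g xs = map e' is" using g by (simp add: "is")
    ultimately show "rel (restrict_struct \<A> E) R xs \<longleftrightarrow> rel (restrict_struct \<A> F) R (map g xs)"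
      using similar_atoms[OF e(3) D, of "is" R] xs by (simp del: map_map)
  qed simp
  then show ?thesis by (auto simp: isomorphic_def)
qed

end

section \<open>Trees of height \<open>\<omega>\<close>\<close>

lemma order_type_eq_iff:
  assumes "Well_order r" "Well_order s"
  shows "order_type r = order_type s \<longleftrightarrow> (r, s) \<in> ordIso"
  using Quotient3_rel[OF Quotient3_ordinal, of r s] ordIso_reflexive[OF assms(1)]
    ordIso_reflexive[OF assms(2)] by simp

locale hausdorff =
  fixes r :: "'a rel"
  assumes hausdorff: "hausdorff_tree r"
begin

lemma r_refl: "t \<in> Field r \<Longrightarrow> (t, t) \<in> r"
  and r_trans: "(s, t) \<in> r \<Longrightarrow> (t, u) \<in> r \<Longrightarrow> (s, u) \<in> r"
  and r_antisym: "(s, t) \<in> r \<Longrightarrow> (t, s) \<in> r \<Longrightarrow> s = t"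
proof -
  have "refl_on (Field r) r" "trans r" "antisym r"
    using hausdorff by (simp_all add: hausdorff_tree_def order_on_defs)
  then show "t \<in> Field r \<Longrightarrow> (t, t) \<in> r" "(s, t) \<in> r \<Longrightarrow> (t, u) \<in> r \<Longrightarrow> (s, u) \<in> r"
    "(s, t) \<in> r \<Longrightarrow> (t, s) \<in> r \<Longrightarrow> s = t"
    by (auto dest: refl_onD transD antisymD)
qed

lemma comparable_below:
  assumes "(a, t) \<in> r" "(b, t) \<in> r"
  shows "(a, b) \<in> r \<or> (b, a) \<in> r"
proof (cases "a = t \<or> b = t \<or> a = b")
  case True
  moreover have "a \<in> Field r" using assms(1) by (simp add: FieldI1)
  ultimately show ?thesis using assms r_refl by blast
next
  case False
  then have ab: "a \<in> underS r t" "b \<in> underS r t" using assms by (auto simp: underS_def)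
  have "t \<in> Field r" using assms(1) by (rule FieldI2)
  then have "total_on (underS r t) (Restr r (underS r t))"
    using hausdorff unfolding hausdorff_tree_def well_order_on_def linear_order_on_def by blast
  then show ?thesis using ab False unfolding total_on_def by blast
qed

lemma underS_suc:
  assumes "s \<in> suc r t"
  shows "underS r s = insert t (underS r t)"
proof -
  have s: "(t, s) \<in> r" "s \<noteq> t" "aboveS r t \<inter> underS r s = {}"
    using assms by (auto simp: suc_def aboveS_def)
  have "u \<in> insert t (underS r t)" if "u \<in> underS r s" for u
    using comparable_below[of u s t] that s by (auto simp: underS_def aboveS_def)
  moreover have "u \<in> underS r s" if "u \<in> underS r t" for u
    using that s r_trans r_antisym by (auto simp: underS_def)
  ultimately show ?thesis using s by (auto simp: underS_def)
qed

lemma suc_Field: "s \<in> suc r t \<Longrightarrow> s \<in> Field r"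
  by (auto simp: suc_def aboveS_def intro: FieldI2)

lemma suc_parent_unique:
  assumes "s \<in> suc r t" "s \<in> suc r u"
  shows "t = u"
proof -
  have "insert t (underS r t) = insert u (underS r u)" using assms underS_suc by metis
  then have "t \<in> insert u (underS r u)" "u \<in> insert t (underS r t)" by blast+
  then show ?thesis using r_antisym[of t u] by (auto simp: underS_def)
qed

lemma suc_antichain:
  assumes "x \<in> suc r t" "y \<in> suc r t" "(x, y) \<in> r"
  shows "x = y"
  using assms by (auto simp: suc_def aboveS_def underS_def)

lemma branch_Chains: "b \<in> branch r \<Longrightarrow> b \<in> Chains r"
  by (simp add: branch_def)

lemma branch_maximal: "b \<in> branch r \<Longrightarrow> c \<in> Chains r \<Longrightarrow> b \<subseteq> c \<Longrightarrow> c = b"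
  by (simp add: branch_def)

lemma Chains_comparable: "C \<in> Chains r \<Longrightarrow> s \<in> C \<Longrightarrow> t \<in> C \<Longrightarrow> (s, t) \<in> r \<or> (t, s) \<in> r"
  by (auto simp: Chains_def)

lemma Chains_Field: "C \<in> Chains r \<Longrightarrow> t \<in> C \<Longrightarrow> t \<in> Field r"
  using Chains_comparable[of C t t] by (auto intro: FieldI1)

lemma branch_insert:
  assumes b: "b \<in> branch r" and s: "s \<in> Field r" "\<And>u. u \<in> b \<Longrightarrow> (u, s) \<in> r \<or> (s, u) \<in> r"
  shows "s \<in> b"
proof -
  have "insert s b \<in> Chains r"
    using Chains_comparable[OF branch_Chains[OF b]] s r_refl unfolding Chains_def by blast
  then show ?thesis using branch_maximal[OF b, of "insert s b"] by blast
qed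

lemma branch_down:
  assumes b: "b \<in> branch r" and t: "t \<in> b" "(s, t) \<in> r"
  shows "s \<in> b"
proof (rule branch_insert[OF b FieldI1[OF t(2)]])
  fix u assume "u \<in> b"
  then have "(u, t) \<in> r \<or> (t, u) \<in> r" using Chains_comparable[OF branch_Chains[OF b]] t(1) by blast
  then show "(u, s) \<in> r \<or> (s, u) \<in> r" using comparable_below t(2) r_trans by blast
qed

text \<open>For well-foundedness, a member \<open>x\<close> of \<open>Q\<close> is either minimal or
  has members of \<open>Q\<close> below it, and these have a minimal one inside the well-ordered set
  \<open>underS r x\<close>.\<close>

lemma Well_order_Chains:
  assumes C: "C \<in> Chains r"
  shows "Field (Restr r C) = C" "Well_order (Restr r C)"
proof -
  have refl: "(t, t) \<in> r" if "t \<in> C" for t using Chains_comparable[OF C that that] by simp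
  then show F: "Field (Restr r C) = C" by (auto simp: Field_def)
  have "wf (Restr r C - Id)"
  proof (rule wfI_min)
    fix x Q assume x: "x \<in> (Q :: 'a set)"
    show "\<exists>z\<in>Q. \<forall>y. (y, z) \<in> Restr r C - Id \<longrightarrow> y \<notin> Q"
    proof (cases "\<exists>y. y \<in> Q \<inter> underS r x")
      case False
      then show ?thesis using x by (auto simp: underS_def)
    next
      case True
      then obtain y where y: "y \<in> Q \<inter> underS r x" by blast
      then have "x \<in> Field r" by (auto simp: underS_def intro: FieldI2)
      then have "wf (Restr r (underS r x) - Id)"
        using hausdorff by (simp add: hausdorff_tree_def well_order_on_def)
      then obtain z where z: "z \<in> Q \<inter> underS r x"
        "\<And>y. (y, z) \<in> Restr r (underS r x) - Id \<Longrightarrow> y \<notin> Q \<inter> underS r x"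
        using y by (rule wfE_min) blast
      have "y \<notin> Q" if yz: "(y, z) \<in> Restr r C - Id" for y
      proof -
        have "y \<in> underS r x" using yz z(1) r_trans r_antisym by (auto simp: underS_def)
        then show ?thesis using z yz by auto
      qed
      then show ?thesis using z(1) by blast
    qed
  qed
  moreover have "trans (Restr r C)" using r_trans unfolding trans_def by blast
  moreover have "antisym (Restr r C)" using r_antisym unfolding antisym_def by blast
  moreover have "total_on C (Restr r C)" using Chains_comparable[OF C] unfolding total_on_def by blast
  moreover have "refl_on C (Restr r C)" using refl by (auto simp: refl_on_def)
  ultimately show "Well_order (Restr r C)" unfolding F order_on_defs by auto
qed

text \<open>If some node had infinite height, then, by levelness, each of the \<open>2\<^sup>\<omega>\<close> paths of
  length \<open>\<omega>\<close> through a binary subtree would have a node above it.\<close>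

lemma finite_underS:
  assumes lev: "leveled r" and cnt: "countable (Field r)"
    and two: "\<And>t. t \<in> Field r \<Longrightarrow> \<exists>x\<in>suc r t. \<exists>y\<in>suc r t. x \<noteq> y"
    and ex: "\<And>t. t \<in> Field r \<Longrightarrow> \<exists>b\<in>branch r. t \<in> b"
    and t: "t \<in> Field r"
  shows "finite (underS r t)"
proof (rule ccontr)
  assume inf: "infinite (underS r t)"
  obtain b where b: "b \<in> branch r" "t \<in> b" using ex t by blast
  obtain m where m: "m \<in> Field r" "\<And>t. t \<in> Field r \<Longrightarrow> (m, t) \<in> r"
    using hausdorff unfolding hausdorff_tree_def by blast
  obtain p q where pq: "\<And>t. t \<in> Field r \<Longrightarrow> p t \<in> suc r t" "\<And>t. t \<in> Field r \<Longrightarrow> q t \<in> suc r t"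
    "\<And>t. t \<in> Field r \<Longrightarrow> p t \<noteq> q t"
    using two by metis
  \<comment> \<open>Coding the paths by sets of naturals lets Cantor's theorem conclude.\<close>
  define c where "c A = rec_nat m (\<lambda>n t. if n \<in> A then p t else q t)" for A :: "nat set"
  have c_0: "c A 0 = m" and c_Suc: "c A (Suc n) = (if n \<in> A then p (c A n) else q (c A n))" for A n
    by (simp_all add: c_def)
  have cF: "c A n \<in> Field r" for A n
  proof (induction n)
    case (Suc n)
    then show ?case using suc_Field[OF pq(1)] suc_Field[OF pq(2)] by (simp add: c_Suc)
  qed (simp add: c_0 m(1))
  have csuc: "c A (Suc n) \<in> suc r (c A n)" for A n using pq cF by (simp add: c_Suc)
  have under: "underS r (c A n) = c A ` {..<n}" for A n
  proof (induction n)
    case 0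
    have "u = m" if "(u, m) \<in> r" for u
      using r_antisym[OF that m(2)[OF FieldI1[OF that]]] .
    then show ?case by (auto simp: c_0 underS_def)
  next
    case (Suc n)
    then show ?case using underS_suc[OF csuc[of A n]] by (simp add: lessThan_Suc)
  qed
  have chain: "range (c A) \<in> Chains r" for A
  proof -
    have less: "(c A i, c A j) \<in> r" if "i \<le> j" for i j
      using under[of A j] that cF r_refl by (cases "i = j") (auto simp: underS_def)
    have "(c A i, c A j) \<in> r \<or> (c A j, c A i) \<in> r" for i j using less[of i j] less[of j i] by linarith
    then show ?thesis unfolding Chains_def by auto
  qed
  have "\<exists>x. \<forall>n. c A n \<in> underS r x" for A
  proof -
    \<comment> \<open>Otherwise levelness makes the path isomorphic to \<open>b\<close>; but nodes
      of the path have finitely many predecessors, and \<open>t\<close> in \<open>b\<close> has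
      infinitely many.\<close>
    have "range (c A) \<notin> branch r"
    proof
      assume br: "range (c A) \<in> branch r"
      let ?b = "Restr r b" and ?c = "Restr r (range (c A))"
      have "order_type ?b = order_type ?c"
        using lev br b(1) unfolding leveled_def branch_height_def by blast
      moreover have wo: "Well_order ?b" "Field ?b = b" "Well_order ?c" "Field ?c = range (c A)"
        using Well_order_Chains[OF branch_Chains[OF b(1)]] Well_order_Chains[OF chain] by auto
      ultimately have "(?b, ?c) \<in> ordIso" using order_type_eq_iff by blast
      then obtain f where "iso ?b ?c f" unfolding ordIso_def by blast
      then have "bij_betw f (under ?b t) (under ?c (f t))" and "f t \<in> range (c A)"
        using b(2) wo unfolding iso_def embed_def by (auto dest: bij_betwE)
      then obtain n where n: "bij_betw f (under ?b t) (under ?c (c A n))" by auto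
      have "under ?c (c A n) \<subseteq> insert (c A n) (underS r (c A n))"
        by (auto simp: under_def underS_def)
      then have "finite (under ?c (c A n))" unfolding under by (rule finite_subset) simp
      then have "finite (under ?b t)" using n bij_betw_finite by blast
      moreover have "underS r t \<subseteq> under ?b t"
        using branch_down[OF b] b(2) by (auto simp: underS_def under_def)
      ultimately show False using inf finite_subset by blast
    qed
    then obtain d where d: "d \<in> Chains r" "range (c A) \<subseteq> d" "d \<noteq> range (c A)"
      using chain unfolding branch_def by blast
    then obtain x where x: "x \<in> d" "x \<notin> range (c A)" by blast
    have "c A n \<in> underS r x" for n
    proof -
      have "(c A n, x) \<in> r \<or> (x, c A n) \<in> r" using Chains_comparable[OF d(1)] d(2) x(1) by blast
      moreover have "x \<noteq> c A n" using x(2) by blast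
      moreover have "x \<notin> underS r (c A n)" using x(2) unfolding under by blast
      ultimately show ?thesis by (auto simp: underS_def)
    qed
    then show ?thesis by blast
  qed
  then obtain u where u: "\<And>A n. c A n \<in> underS r (u A)" by metis
  \<comment> \<open>Paths below a common node cannot part, since distinct successors of a node are
    incomparable.\<close>
  have "inj u"
  proof (rule injI)
    fix A B assume uAB: "u A = u B"
    have eq: "c A n = c B n" for n
    proof (induction n)
      case (Suc n)
      have "(c A (Suc n), c B (Suc n)) \<in> r \<or> (c B (Suc n), c A (Suc n)) \<in> r"
        using comparable_below[of _ "u A"] u[of A "Suc n"] u[of B "Suc n"] uAB by (auto simp: underS_def)
      moreover have "c A (Suc n) \<in> suc r (c A n)" "c B (Suc n) \<in> suc r (c A n)"
        using csuc[of A n] csuc[of B n] Suc by simp_all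
      ultimately show ?case using suc_antichain by metis
    qed (simp add: c_0)
    have "n \<in> A \<longleftrightarrow> n \<in> B" for n
      using eq[of "Suc n"] eq[of n] pq(3)[OF cF[of B n]] by (auto simp: c_Suc split: if_splits)
    then show "A = B" by blast
  qed
  moreover have "range u \<subseteq> Field r"
  proof -
    have "u A \<in> Field r" for A using u[of A 0] by (auto simp: underS_def intro: FieldI2)
    then show ?thesis by blast
  qed
  ultimately have "countable (UNIV :: nat set set)"
    using countable_subset[OF _ cnt] countable_image_inj_on by blast
  then have "range (from_nat_into UNIV) = (UNIV :: nat set set)"
    by (intro range_from_nat_into) auto
  then show False using Cantors_theorem[of "UNIV :: nat set"] by auto
qed

end

section \<open>Branches as sequences of nodes indexed by level\<close>

locale omega_tree = hausdorff r for r :: "'a rel" +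
  assumes finite_under: "t \<in> Field r \<Longrightarrow> finite (underS r t)"
    and no_maximal: "t \<in> Field r \<Longrightarrow> aboveS r t \<noteq> {}"
begin

definition level :: "'a \<Rightarrow> nat" where "level t = card (underS r t)"

definition node :: "'a set \<Rightarrow> nat \<Rightarrow> 'a" where "node b n = (THE t. t \<in> b \<and> level t = n)"

lemma level_less:
  assumes "(s, t) \<in> r" "s \<noteq> t"
  shows "level s < level t"
proof -
  have "underS r s \<subset> underS r t"
    using assms r_trans r_antisym by (auto simp: underS_def)
  then show ?thesis
    unfolding level_def using finite_under[OF FieldI2[OF assms(1)]] by (simp add: psubset_card_mono)
qed

lemma level_suc:
  assumes "s \<in> suc r t"
  shows "level s = Suc (level t)"
proof -
  have "t \<in> Field r" using assms by (auto simp: suc_def aboveS_def intro: FieldI1)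
  moreover have "t \<notin> underS r t" by (simp add: underS_def)
  ultimately show ?thesis
    using finite_under[of t] by (simp add: level_def underS_suc[OF assms])
qed

text \<open>Any bijection \<open>f\<close> will do: the order transported along it and the given one
  are well-orders of the same finite set, hence isomorphic. This links levels to the heights in
  purity and in \<open>S \<alpha>\<close>.\<close>

lemma height_level:
  assumes "s \<in> Field r" "t \<in> Field r" "level s = level t"
  shows "height r s = height r t"
proof -
  have wo: "Field (Restr r (underS r u)) = underS r u \<and> well_order_on (underS r u) (Restr r (underS r u))"
    if "u \<in> Field r" for u
  proof -
    have "well_order_on (underS r u) (Restr r (underS r u))"
      using hausdorff that unfolding hausdorff_tree_def by blast
    then show ?thesis using well_order_on_Field by metis
  qed
  obtain f where f: "bij_betw f (underS r s) (underS r t)"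
    using finite_same_card_bij finite_under assms unfolding level_def by metis
  define a where "a = Restr r (underS r s)"
  have "(a, dir_image a f) \<in> ordIso"
    using f wo[OF assms(1)] by (intro dir_image_ordIso) (auto simp: a_def bij_betw_def)
  moreover have "well_order_on (underS r t) (dir_image a f)"
  proof -
    have "Well_order (dir_image a f)"
      using f wo[OF assms(1)] by (intro Well_order_dir_image) (auto simp: a_def bij_betw_def)
    moreover have "Field (dir_image a f) = underS r t"
      using f wo[OF assms(1)] by (simp add: dir_image_Field a_def bij_betw_def)
    ultimately show ?thesis by simp
  qed
  ultimately have "(a, Restr r (underS r t)) \<in> ordIso"
    using finite_well_order_on_ordIso[OF finite_under[OF assms(2)]] wo[OF assms(2)] ordIso_transitive by blast
  then show ?thesis
    unfolding height_def a_def using order_type_eq_iff[of "Restr r (underS r s)" "Restr r (underS r t)"]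
      wo[OF assms(1)] wo[OF assms(2)] by simp
qed

lemma branch_above:
  assumes b: "b \<in> branch r" and t: "t \<in> b"
  shows "\<exists>s\<in>b. s \<in> aboveS r t"
proof (rule ccontr)
  assume none: "\<not> ?thesis"
  obtain v where v: "v \<in> aboveS r t"
    using no_maximal[OF Chains_Field[OF branch_Chains[OF b] t]] by blast
  have "v \<in> b"
  proof (rule branch_insert[OF b])
    show "v \<in> Field r" using v by (auto simp: aboveS_def intro: FieldI2)
    fix u assume u: "u \<in> b"
    then have "(u, t) \<in> r"
      using Chains_comparable[OF branch_Chains[OF b] u t] none by (auto simp: aboveS_def)
    then show "(u, v) \<in> r \<or> (v, u) \<in> r" using v r_trans by (auto simp: aboveS_def)
  qed
  then show False using none v by blast
qed

lemma level_inj_branch: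
  assumes "b \<in> branch r" "s \<in> b" "t \<in> b" "level s = level t"
  shows "s = t"
  using Chains_comparable[OF branch_Chains[OF assms(1)] assms(2,3)] level_less[of s t]
    level_less[of t s] assms(4) by auto

lemma branch_le_level:
  assumes "b \<in> branch r" "s \<in> b" "t \<in> b" "level s \<le> level t"
  shows "(s, t) \<in> r"
proof (cases "s = t")
  case True
  then show ?thesis using Chains_comparable[OF branch_Chains[OF assms(1)] assms(2,3)] by simp
next
  case False
  then show ?thesis
    using Chains_comparable[OF branch_Chains[OF assms(1)] assms(2,3)] level_less[of t s] assms(4) by auto
qed

lemma branch_level_exists:
  assumes b: "b \<in> branch r"
  shows "\<exists>t\<in>b. level t = n"
proof (induction n)
  case 0
  obtain m where m: "m \<in> Field r" "\<And>t. t \<in> Field r \<Longrightarrow> (m, t) \<in> r"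
    using hausdorff unfolding hausdorff_tree_def by blast
  have "m \<in> b"
    using m Chains_Field[OF branch_Chains[OF b]] by (intro branch_insert[OF b]) auto
  moreover have "underS r m = {}"
  proof -
    have "u = m" if "(u, m) \<in> r" for u
      using r_antisym[OF that m(2)[OF FieldI1[OF that]]] .
    then show ?thesis by (auto simp: underS_def)
  qed
  ultimately show ?case by (intro bexI[of _ m]) (simp_all add: level_def)
next
  case (Suc n)
  then obtain t where t: "t \<in> b" "level t = n" by blast
  obtain s0 where "s0 \<in> b \<inter> aboveS r t" using branch_above[OF b t(1)] by blast
  \<comment> \<open>Least level among members of \<open>b\<close> above \<open>t\<close>; as
    branches are closed downwards, no node of the whole tree lies strictly between.\<close>
  then obtain s where s: "s \<in> b \<inter> aboveS r t" "\<And>u. u \<in> b \<inter> aboveS r t \<Longrightarrow> level s \<le> level u"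
    using ex_has_least_nat[of "\<lambda>s. s \<in> b \<inter> aboveS r t" s0 level] by blast
  have "aboveS r t \<inter> underS r s = {}"
  proof (rule ccontr)
    assume "\<not> ?thesis"
    then obtain u where u: "u \<in> aboveS r t" "(u, s) \<in> r" "u \<noteq> s" by (auto simp: underS_def)
    then have "u \<in> b" using branch_down[OF b, of s u] s(1) by blast
    then show False using s(2)[of u] u level_less[OF u(2,3)] by simp
  qed
  then have "s \<in> suc r t" using s(1) by (simp add: suc_def)
  then show ?case using level_suc t(2) s(1) by blast
qed

lemma node:
  assumes "b \<in> branch r"
  shows "node b n \<in> b" "level (node b n) = n"
proof -
  obtain t where t: "t \<in> b \<and> level t = n" using branch_level_exists[OF assms] by blast
  have "node b n \<in> b \<and> level (node b n) = n"
    unfolding node_def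
  proof (rule theI[of "\<lambda>t. t \<in> b \<and> level t = n", OF t])
    show "s = t" if "s \<in> b \<and> level s = n" for s
      using level_inj_branch[OF assms, of s t] that t by simp
  qed
  then show "node b n \<in> b" "level (node b n) = n" by auto
qed

lemma node_level: "b \<in> branch r \<Longrightarrow> t \<in> b \<Longrightarrow> node b (level t) = t"
  using level_inj_branch[of b "node b (level t)" t] node[of b "level t"] by simp

lemma node_Field: "b \<in> branch r \<Longrightarrow> node b n \<in> Field r"
  using Chains_Field branch_Chains node(1) by blast

lemma branch_range_node:
  assumes "b \<in> branch r"
  shows "b = range (node b)"
proof
  show "b \<subseteq> range (node b)" using node_level[OF assms] by (metis rangeI subsetI)
  show "range (node b) \<subseteq> b" using node(1)[OF assms] by blast
qed

lemma node_Suc: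
  assumes b: "b \<in> branch r"
  shows "node b (Suc n) \<in> suc r (node b n)"
proof -
  have le: "(node b n, node b (Suc n)) \<in> r" using b by (intro branch_le_level) (auto simp: node)
  moreover have ne: "node b n \<noteq> node b (Suc n)" using node(2)[OF b] by (metis n_not_Suc_n)
  moreover have "aboveS r (node b n) \<inter> underS r (node b (Suc n)) = {}"
  proof (rule ccontr)
    assume "\<not> ?thesis"
    then obtain u where "(node b n, u) \<in> r" "node b n \<noteq> u" "(u, node b (Suc n)) \<in> r" "u \<noteq> node b (Suc n)"
      by (auto simp: aboveS_def underS_def)
    then have "level (node b n) < level u" "level u < level (node b (Suc n))"
      using level_less by blast+
    then show False using node(2)[OF b] by simp
  qed
  ultimately show ?thesis by (auto simp: suc_def aboveS_def)
qed

lemma branch_succ_node: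
  assumes b: "b \<in> branch r"
  shows "branch_succ r b (node b n) = node b (Suc n)"
  unfolding branch_succ_def
proof (rule the_equality)
  have above: "node b (Suc n) \<in> b \<inter> aboveS r (node b n)"
    using node_Suc[OF b] node(1)[OF b] by (simp add: suc_def)
  have least: "(node b (Suc n), u) \<in> r" if u: "u \<in> b \<inter> aboveS r (node b n)" for u
  proof -
    have "n < level u" using u level_less[of "node b n" u] node(2)[OF b] by (auto simp: aboveS_def)
    then show ?thesis using u by (intro branch_le_level[OF b]) (auto simp: node[OF b])
  qed
  then show "node b (Suc n) \<in> b \<inter> aboveS r (node b n) \<and>
      (\<forall>u\<in>b \<inter> aboveS r (node b n). (node b (Suc n), u) \<in> r)"
    using above by blast
  show "s = node b (Suc n)"
    if "s \<in> b \<inter> aboveS r (node b n) \<and> (\<forall>u\<in>b \<inter> aboveS r (node b n). (s, u) \<in> r)" for s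
    using that above least r_antisym by blast
qed

lemma branch_family_node:
  assumes D: "D \<subseteq> branch r" and dense: "\<And>t. t \<in> Field r \<Longrightarrow> \<exists>b\<in>D. t \<in> b"
  shows "branch_family (suc r) D node"
proof
  have br: "b \<in> branch r" if "b \<in> D" for b using that D by blast
  obtain m where m: "m \<in> Field r" "\<And>t. t \<in> Field r \<Longrightarrow> (m, t) \<in> r"
    using hausdorff unfolding hausdorff_tree_def by blast
  show "D \<noteq> {}" using dense m(1) by blast
  have "node b 0 = m" if "b \<in> D" for b
  proof (rule ccontr)
    assume "node b 0 \<noteq> m"
    then have "level m < level (node b 0)" using m(2) node_Field[OF br[OF that]] level_less by metis
    then show False using node(2)[OF br[OF that]] by simp
  qed
  then show "node a 0 = node b 0" if "a \<in> D" "b \<in> D" for a b using that by simp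
  show "node b (Suc n) \<in> suc r (node b n)" if "b \<in> D" for b n using node_Suc br that by blast
  show "m = n" if "a \<in> D" "b \<in> D" "node a m = node b n" for a b m n
    using that node(2) br by metis
  show "node a n = node b n" if "a \<in> D" "b \<in> D" "node a (Suc n) = node b (Suc n)" for a b n
    using suc_parent_unique node_Suc br that by metis
  show "\<exists>c\<in>D. node c n = node b n \<and> node c (Suc n) = x" if b: "b \<in> D" and x: "x \<in> suc r (node b n)"
    for b n x
  proof -
    obtain c where c: "c \<in> D" "x \<in> c" using dense suc_Field[OF x] by blast
    have "level x = Suc n" using level_suc[OF x] node(2)[OF br[OF b]] by simp
    then have "node c (Suc n) = x" using node_level[OF br[OF c(1)] c(2)] by simp
    moreover from this have "node c n = node b n"
      using suc_parent_unique[OF _ x] node_Suc[OF br[OF c(1)], of n] by simp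
    ultimately show ?thesis using c(1) by blast
  qed
  show "a = b" if "a \<in> D" "b \<in> D" "\<And>n. node a n = node b n" for a b
  proof -
    have "node a = node b" using that(3) by (rule ext)
    then show ?thesis
      using branch_range_node[OF br[OF that(1)]] branch_range_node[OF br[OF that(2)]] by simp
  qed
qed

text \<open>Branches agree on an initial segment of levels, so their greatest common node is the
  last one before the first disagreement. If all of them coincide, both sides are false, as a branch
  has no last node.\<close>

lemma is_greatest_Inter_iff:
  assumes A: "A \<subseteq> branch r" "a \<in> A"
  shows "is_greatest r (\<Inter>A) m \<longleftrightarrow>
    (\<exists>n. m = node a n \<and> (\<forall>b\<in>A. node b n = node a n) \<and> (\<exists>b\<in>A. node b (Suc n) \<noteq> node a (Suc n)))"
proof
  have br: "b \<in> branch r" if "b \<in> A" for b using that A by blast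
  have inter: "\<forall>b\<in>A. node b (level u) = u" if "u \<in> \<Inter>A" for u
    using that node_level br by blast
  {
    assume g: "is_greatest r (\<Inter>A) m"
    then have mA: "m \<in> \<Inter>A" by (simp add: is_greatest_def)
    have "\<exists>b\<in>A. node b (Suc (level m)) \<noteq> node a (Suc (level m))"
    proof (rule ccontr)
      assume "\<not> ?thesis"
      then have "node a (Suc (level m)) \<in> \<Inter>A" using node(1) br by (metis InterI)
      then have "(node a (Suc (level m)), m) \<in> r" using g by (simp add: is_greatest_def)
      then have "Suc (level m) \<le> level m"
        using level_less[of "node a (Suc (level m))" m] node(2)[OF br[OF A(2)]]
        by (metis less_imp_le_nat order_refl)
      then show False by simp
    qed
    then show "\<exists>n. m = node a n \<and> (\<forall>b\<in>A. node b n = node a n) \<and> (\<exists>b\<in>A. node b (Suc n) \<noteq> node a (Suc n))"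
      using inter[OF mA] A(2) by (intro exI[of _ "level m"]) auto
  }
  assume "\<exists>n. m = node a n \<and> (\<forall>b\<in>A. node b n = node a n) \<and> (\<exists>b\<in>A. node b (Suc n) \<noteq> node a (Suc n))"
  then obtain n b where n: "m = node a n" "\<And>b. b \<in> A \<Longrightarrow> node b n = node a n"
    and b: "b \<in> A" "node b (Suc n) \<noteq> node a (Suc n)" by blast
  have "m \<in> \<Inter>A" using node(1) br n by (metis InterI)
  moreover have "(u, m) \<in> r" if u: "u \<in> \<Inter>A" for u
  proof -
    have "level u \<le> n"
    proof (rule ccontr)
      assume "\<not> level u \<le> n"
      moreover have "node b k = node a k" if "k \<le> level u" for k
        using that
      proof (induction rule: inc_induct)
        case base
        show ?case using inter[OF u] b(1) A(2) by simp
      next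
        case (step k)
        then show ?case using suc_parent_unique[OF node_Suc[OF br[OF b(1)]]] node_Suc[OF br[OF A(2)], of k] by metis
      qed
      ultimately show False using b(2) by (meson not_less_eq_eq)
    qed
    then show ?thesis
      using u A(2) n(1) node[OF br[OF A(2)]] by (intro branch_le_level[OF br[OF A(2)]]) auto
  qed
  ultimately show "is_greatest r (\<Inter>A) m" by (simp add: is_greatest_def)
qed

text \<open>The intersection over the empty tuple is \<open>UNIV\<close>; this makes nullary symbols
  false in the product.\<close>

lemma not_is_greatest_UNIV: "\<not> is_greatest r UNIV m"
proof
  assume g: "is_greatest r UNIV m"
  then have "(m, m) \<in> r" by (simp add: is_greatest_def)
  then obtain v where "v \<in> aboveS r m" using no_maximal[OF FieldI1] by blast
  then show False using g r_antisym[of m v] by (simp add: is_greatest_def aboveS_def)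
qed

lemma meet_height_node:
  assumes ab: "a \<in> branch r" "b \<in> branch r" "node a n = node b n" "node a (Suc n) \<noteq> node b (Suc n)"
  shows "meet_height r a b = height r (node a n)"
proof -
  have "is_greatest r (a \<inter> b) (node a n)"
    using is_greatest_Inter_iff[of "{a, b}" a "node a n"] ab by auto
  then have "(THE m. is_greatest r (a \<inter> b) m) = node a n"
    using r_antisym by (intro the_equality) (auto simp: is_greatest_def)
  then show ?thesis using ab(4) by (auto simp: meet_height_def)
qed

end

section \<open>Atomic relations of the product\<close>

context omega_tree
begin

text \<open>Replaces the meet by its level, the form that matches \<open>splits\<close> and
  \<open>rel_at\<close>, so that similarity decides the relations of the product.\<close>

lemma product_rel_iff:
  assumes br: "e ` set is \<subseteq> branch r"
  shows "rel (product r \<M>) R (map e is) \<longleftrightarrow>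
    (\<exists>n. \<exists>k\<in>set is. (\<forall>i\<in>set is. node (e i) n = node (e k) n) \<and>
      (\<exists>i\<in>set is. node (e i) (Suc n) \<noteq> node (e k) (Suc n)) \<and>
      rel (\<M> (node (e k) n)) R (map (\<lambda>i. node (e i) (Suc n)) is))"
    (is "_ \<longleftrightarrow> (\<exists>n. \<exists>k\<in>set is. ?P n k)")
proof -
  have succ: "map (\<lambda>a. branch_succ r a (node (e k) n)) (map e is) = map (\<lambda>i. node (e i) (Suc n)) is"
    if k: "\<forall>i\<in>set is. node (e i) n = node (e k) n" for n k
  proof -
    have "branch_succ r (e i) (node (e k) n) = node (e i) (Suc n)" if "i \<in> set is" for i
    proof -
      have "node (e k) n = node (e i) n" using k that by simp
      then show ?thesis using branch_succ_node[of "e i" n] br that by auto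
    qed
    then show ?thesis by simp
  qed
  show ?thesis
  proof (cases "is = []")
    case True
    then show ?thesis using not_is_greatest_UNIV by (simp add: product_def)
  next
    case False
    have rel: "rel (product r \<M>) R (map e is) \<longleftrightarrow> (\<exists>m. is_greatest r (\<Inter>(e ` set is)) m \<and>
        rel (\<M> m) R (map (\<lambda>a. branch_succ r a m) (map e is)))"
      by (simp add: product_def)
    have at: "(\<exists>m. is_greatest r (\<Inter>(e ` set is)) m \<and>
        rel (\<M> m) R (map (\<lambda>a. branch_succ r a m) (map e is))) \<longleftrightarrow> (\<exists>n. ?P n k)"
      if k: "k \<in> set is" for k
    proof -
      have g: "is_greatest r (\<Inter>(e ` set is)) m \<longleftrightarrow>
        (\<exists>n. m = node (e k) n \<and> (\<forall>i\<in>set is. node (e i) n = node (e k) n) \<and>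
          (\<exists>i\<in>set is. node (e i) (Suc n) \<noteq> node (e k) (Suc n)))" for m
        using is_greatest_Inter_iff[OF br, of "e k" m] k by (simp add: ball_simps(9) bex_simps(7))
      show ?thesis
      proof
        assume "\<exists>m. is_greatest r (\<Inter>(e ` set is)) m \<and>
          rel (\<M> m) R (map (\<lambda>a. branch_succ r a m) (map e is))"
        then obtain n where agree: "\<forall>i\<in>set is. node (e i) n = node (e k) n"
          and split: "\<exists>i\<in>set is. node (e i) (Suc n) \<noteq> node (e k) (Suc n)"
          and "rel (\<M> (node (e k) n)) R (map (\<lambda>a. branch_succ r a (node (e k) n)) (map e is))"
          unfolding g by blast
        then have "?P n k" unfolding succ[OF agree] by blast
        then show "\<exists>n. ?P n k" ..
      next
        assume "\<exists>n. ?P n k"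
        then obtain n where n: "?P n k" ..
        then have "rel (\<M> (node (e k) n)) R (map (\<lambda>a. branch_succ r a (node (e k) n)) (map e is))"
          by (subst succ) auto
        moreover have "is_greatest r (\<Inter>(e ` set is)) (node (e k) n)" unfolding g using n by blast
        ultimately show "\<exists>m. is_greatest r (\<Inter>(e ` set is)) m \<and>
          rel (\<M> m) R (map (\<lambda>a. branch_succ r a m) (map e is))" by blast
      qed
    qed
    obtain k where "k \<in> set is" using False by (meson list.set_sel(1))
    then show ?thesis unfolding rel using at by blast
  qed
qed

end

theorem theorem3p1:
  fixes r :: "'a rel"
    and L :: "'r language"
    and \<M> :: "'a \<Rightarrow> ('r, 'a) struct"
    and \<D> :: "(('r, 'a ordinal) esym, 'a set) struct"
  assumes "family_tree r \<M>"
    and "omega_pure r L \<M>"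
    and "\<And>t. t \<in> Field r \<Longrightarrow> indivisible L (\<M> t)"
    and "substructure (expanded_language r L) \<D> (product_s r \<M>)"
    and "countable (univ \<D>)"
    and "dense_in_tree r \<D>"
  shows "elementarily_indivisible (expanded_language r L) \<D>"
proof -
  define D where "D = univ \<D>"
  interpret hausdorff r
    using assms(1) by unfold_locales (simp add: family_tree_def)
  have D: "D \<subseteq> branch r"
    using assms(4) by (simp add: D_def substructure_def product_s_def product_def)
  have dense: "\<exists>b\<in>D. t \<in> b" if "t \<in> Field r" for t
    using assms(6) that by (simp add: dense_in_tree_def D_def)
  have univ_M: "univ (\<M> t) = suc r t" if "t \<in> Field r" for t
    using assms(1) that by (simp add: family_tree_def)
  have pure: "countable (univ (\<M> t))" "infinite (univ (\<M> t))" "transitive_struct L (\<M> t)"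
    "ultrahomogeneous L (\<M> t)" if "t \<in> Field r" for t
    using assms(2) that by (auto simp: omega_pure_def)
  have "finite (underS r t)" if t: "t \<in> Field r" for t
  proof (rule finite_underS[OF _ _ _ _ t])
    show "leveled r" using assms(1) by (simp add: family_tree_def)
    show "countable (Field r)" using assms(2) by (simp add: omega_pure_def)
    show "\<exists>x\<in>suc r t. \<exists>y\<in>suc r t. x \<noteq> y" if "t \<in> Field r" for t
    proof (rule ccontr)
      assume "\<not> ?thesis"
      then obtain x where "suc r t \<subseteq> {x}" by blast
      then have "finite (suc r t)" by (rule finite_subset) simp
      then show False using pure(2)[OF that] univ_M[OF that] by simp
    qed
    show "\<exists>b\<in>branch r. t \<in> b" if "t \<in> Field r" for t
      using dense[OF that] D by blast
  qed
  then interpret omega_tree r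
    using assms(1) by unfold_locales (simp_all add: family_tree_def)
  have br: "b \<in> branch r" if "b \<in> D" for b using that D by blast
  have F: "node b n \<in> Field r" if "b \<in> D" for b n using node_Field br that by blast
  interpret fam: branch_family "suc r" D node
    by (rule branch_family_node[OF D dense])
  have VF: "t \<in> Field r" if "t \<in> fam.V" for t
    using that F by (auto simp: fam.V_def)
  interpret fam: branch_family_copies "suc r" D node "\<lambda>t. copy L (\<M> t)"
  proof
    fix t C R B assume "t \<in> fam.V"
    then have t: "t \<in> Field r" by (rule VF)
    note p = pure[OF t]
    show "copy L (\<M> t) (suc r t)" using copy_refl[of L "\<M> t"] univ_M[OF t] by simp
    show "C \<subseteq> suc r t" if "copy L (\<M> t) C" using that univ_M[OF t] by (simp add: copy_def)
    show "\<exists>C. copy L (\<M> t) C \<and> (C \<inter> R \<noteq> {}) \<noteq> (C \<inter> B \<noteq> {})"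
      if "R \<subseteq> suc r t" "B \<subseteq> suc r t" "R \<inter> B = {}" "R \<union> B \<noteq> {}"
      by (rule indivisible_copy_meets_one[OF assms(3)[OF t] p(1)
            transitive_ultrahomogeneous_automorphism[OF p(3,4,1)]])
        (use that univ_M[OF t] in auto)
  qed
  interpret fam: branch_family_structs "suc r" D node L \<M>
  proof
    fix a b n assume b: "b \<in> D"
    show "univ (\<M> (node b n)) = suc r (node b n)" using univ_M[OF F[OF b]] .
    then show "countable (suc r (node b n))" using pure(1)[OF F[OF b]] by metis
    show "ultrahomogeneous L (\<M> (node b n))" "transitive_struct L (\<M> (node b n))"
      using pure[OF F[OF b]] by auto
    assume a: "a \<in> D"
    have "height r (node a n) = height r (node b n)"
      using height_level[OF F[OF a] F[OF b]] node(2)[OF br[OF a]] node(2)[OF br[OF b]] by simp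
    then show "isomorphic L (\<M> (node a n)) (\<M> (node b n))"
      using assms(2) F[OF a] F[OF b] by (simp add: omega_pure_def)
  qed
  \<comment> \<open>Similar pairs of distinct branches part at the same level, perhaps at different
    nodes, and level determines height. For equal branches both sides are
    \<open>tree_height r\<close>.\<close>
  have heights: "meet_height r (e i) (e j) = meet_height r (e' i) (e' j)"
    if s: "fam.similar I e e'" and eD: "e ` I \<subseteq> D" "e' ` I \<subseteq> D" and ij: "i \<in> I" "j \<in> I"
    for I e e' i j
  proof -
    have mem: "e i \<in> D" "e j \<in> D" "e' i \<in> D" "e' j \<in> D" using eD ij by auto
    note eq = fam.similar_nd[OF s ij]
    show ?thesis
    proof (cases "\<forall>n. node (e i) n = node (e j) n")
      case True
      then have "e i = e j" "e' i = e' j"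
        using fam.nd_eqI[OF mem(1,2)] fam.nd_eqI[OF mem(3,4)] eq by auto
      then show ?thesis by (simp add: meet_height_def)
    next
      case False
      then obtain n where n: "node (e i) n = node (e j) n" "node (e i) (Suc n) \<noteq> node (e j) (Suc n)"
        using fam.nd_0[OF mem(1,2)] nat_induct[of "\<lambda>n. node (e i) n = node (e j) n"] by blast
      then have n': "node (e' i) n = node (e' j) n" "node (e' i) (Suc n) \<noteq> node (e' j) (Suc n)"
        using eq by auto
      have "height r (node (e i) n) = height r (node (e' i) n)"
        using height_level[OF F[OF mem(1)] F[OF mem(3)]] node(2)[OF br[OF mem(1)]]
          node(2)[OF br[OF mem(3)]] by simp
      then show ?thesis
        using meet_height_node[OF br[OF mem(1)] br[OF mem(2)] n]
          meet_height_node[OF br[OF mem(3)] br[OF mem(4)] n'] by simp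
    qed
  qed
  interpret fam: branch_structure "suc r" D node L \<M> "expanded_language r L" \<D>
  proof
    fix I e e' "is" Q
    assume s: "fam.similar I e e'" and eD: "e ` I \<subseteq> D" "e' ` I \<subseteq> D" and "is": "set is \<subseteq> I"
      and Q: "expanded_language r L Q = Some (length is)"
    have rel: "rel \<D> Q (map f is) \<longleftrightarrow> rel (product_s r \<M>) Q (map f is)" if "f ` I \<subseteq> D" for f
    proof -
      have "set (map f is) \<subseteq> univ \<D>" using that "is" by (auto simp: D_def)
      then show ?thesis using assms(4) Q by (simp add: substructure_def)
    qed
    have "rel (product_s r \<M>) Q (map e is) \<longleftrightarrow> rel (product_s r \<M>) Q (map e' is)"
    proof (cases Q)
      case (Old R)
      have LR: "L R = Some (length is)" using Q by (simp add: Old expanded_language_def)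
      have prod: "rel (product r \<M>) R (map f is) \<longleftrightarrow>
          (\<exists>n. \<exists>k\<in>set is. fam.splits f is n \<and> fam.rel_at f R is k n)" if "f ` I \<subseteq> D" for f
      proof -
        have "f ` set is \<subseteq> branch r" using that "is" D by blast
        moreover have "(\<forall>i\<in>set is. node (f i) n = node (f k) n) \<and>
            (\<exists>i\<in>set is. node (f i) (Suc n) \<noteq> node (f k) (Suc n)) \<longleftrightarrow> fam.splits f is n"
          if "k \<in> set is" for n k
          using that unfolding fam.splits_def by metis
        ultimately show ?thesis
          unfolding fam.rel_at_def using product_rel_iff[of f "is" \<M> R] by (metis (no_types, lifting))
      qed
      have "rel (product r \<M>) R (map e is) \<longleftrightarrow> rel (product r \<M>) R (map e' is)"
        unfolding prod[OF eD(1)] prod[OF eD(2)]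
        using fam.similar_rel[OF s "is" LR] fam.similar_splits[OF s "is"] by blast
      then show ?thesis by (simp add: Old product_s_def)
    next
      case (S \<alpha>)
      then have "length is = Suc (Suc 0)"
        using Q by (simp add: expanded_language_def numeral_2_eq_2 split: if_splits)
      then obtain i j where "is = [i, j]" by (auto simp: length_Suc_conv)
      then show ?thesis using heights[OF s eD, of i j] "is" by (simp add: S product_s_def)
    qed
    then show "rel \<D> Q (map e is) \<longleftrightarrow> rel \<D> Q (map e' is)" using rel eD by blast
  qed
  have DD: "restrict_struct \<D> D = \<D>" by (simp add: restrict_struct_def D_def)
  have cD: "countable D" using assms(5) by (simp add: D_def)
  show ?thesis
    unfolding elementarily_indivisible_def
  proof
    fix c :: "'a set \<Rightarrow> bool"
    obtain E where E: "E \<subseteq> {b \<in> D. c b} \<or> E \<subseteq> D - {b \<in> D. c b}" "E \<noteq> {}"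
      "\<forall>b\<in>E. \<forall>n. copy L (\<M> (node b n)) (fam.succs E b n)"
      using fam.full_subset_of_class[of "{b \<in> D. c b}"] by blast
    have ED: "E \<subseteq> D" using E(1) by blast
    have full: "fam.full E" using E ED by (simp add: fam.full_def)
    let ?E = "restrict_struct \<D> E"
    have "elem_substructure (expanded_language r L) ?E \<D>"
      unfolding elem_substructure_def
    proof (intro conjI allI impI; (elim conjE)?)
      show "substructure (expanded_language r L) ?E \<D>"
        using ED by (simp add: substructure_def D_def)
      fix \<phi> and e :: "nat \<Rightarrow> 'a set"
      assume "wf_fm (expanded_language r L) \<phi>" "range e \<subseteq> univ ?E"
      then show "sat ?E e \<phi> \<longleftrightarrow> sat \<D> e \<phi>"
        using fam.similar_sat[OF full fam.full_D, of \<phi> e e] ED fam.similar_refl by (auto simp: DD)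
    qed
    moreover have "monochromatic c (univ ?E)"
      using E(1) by (auto simp: monochromatic_def)
    moreover have "isomorphic (expanded_language r L) ?E \<D>"
      using fam.full_isomorphic[OF full countable_subset[OF ED cD] fam.full_D cD] by (simp add: DD)
    ultimately show "\<exists>\<M>'. elem_substructure (expanded_language r L) \<M>' \<D> \<and>
        monochromatic c (univ \<M>') \<and> isomorphic (expanded_language r L) \<M>' \<D>" by blast
  qed
qed

end
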